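(* Let $G_n=(V_n,E_n)$ be a sequence of $d_n$-regular graphs (finite, simple, undirected, connected) with $|V_n|=n\to\infty$, and let $v_n\in V_n$. Suppose that there exists a sequence $T_n$ such that $\mathcal{T}_{v_n}(G_n)\le T_n$ with high probability. Then, given any $\epsilon>0$, if $0<p_n<1$ is such that $T_n=o(p_n d_n)$, we have $$\mathcal{T}_{v_n}(G_{n,p_n})\le (1+\epsilon)T_n\quad\text{with high probability},$$ where the probability is over both the random choice of $G_{n,p_n}$ and the additional randomness of the push protocol.
   Context: With high probability means with probability $1-o(1)$ as $n\to\infty$. Percolation: for a graph $G=(V,E)$ and $p\in[0,1]$, $G_p$ is the random subgraph of $G$ with vertex set $V$ in which each edge of $G$ is removed independently with probability $1-p$ (and kept otherwise). $G_{n,p_n}$ denotes $(G_n)_{p_n}$. Push protocol on a graph $H$ with vertex set $V$ started at $v\in V$: $I(0)=\{v\}$; at each time $t=0,1,2,\dots$, while $I(t)\ne V$, each $u\in I(t)$ chooses a neighbor $v_u^t$ of $u$ in $H$ uniformly at random, independently of all other choices (over all vertices and times), and $I(t+1)=I(t)\cup\{v_u^t : u\in I(t)\}$ (a vertex with no neighbors makes no choice). The runtime is $\mathcal{T}_v(H)=\min\{t\in\mathbb{N} : I(t)=V\}$, with $\mathcal{T}_v(H)=\infty$ if no such $t$ exists. For the random graph $G_{n,p_n}$, one first samples the graph and then, conditionally on it, runs the push protocol on it. *)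

theory Defs
  imports "HOL-Probability.Probability"
begin

section \<open>Graphs\<close>

record 'a ugraph =
  verts :: "'a set"
  edges :: "'a set set"

definition simple_graph :: "'a ugraph \<Rightarrow> bool" where
  "simple_graph G \<longleftrightarrow> finite (verts G) \<and> (\<forall>e\<in>edges G. e \<subseteq> verts G \<and> card e = 2)"

definition neighbors :: "'a ugraph \<Rightarrow> 'a \<Rightarrow> 'a set" where
  "neighbors G u = {w. {u, w} \<in> edges G}"

definition regular_graph :: "nat \<Rightarrow> 'a ugraph \<Rightarrow> bool" where
  "regular_graph d G \<longleftrightarrow> (\<forall>u\<in>verts G. card (neighbors G u) = d)"

definition connected_graph :: "'a ugraph \<Rightarrow> bool" where
  "connected_graph G \<longleftrightarrow> verts G \<noteq> {} \<and>
     (\<forall>u\<in>verts G. \<forall>w\<in>verts G. (u, w) \<in> {(x, y). {x, y} \<in> edges G}\<^sup>*)"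


section \<open>Percolation\<close>

definition percolation :: "'a ugraph \<Rightarrow> real \<Rightarrow> 'a ugraph pmf" where
  "percolation G p =
     map_pmf (\<lambda>keep. G\<lparr>edges := {e \<in> edges G. keep e}\<rparr>)
       (Pi_pmf (edges G) False (\<lambda>_. bernoulli_pmf p))"


section \<open>The push protocol\<close>

text \<open>An isolated vertex makes no choice, which is encoded by \<open>None\<close>.\<close>

definition choice_pmf :: "'a ugraph \<Rightarrow> 'a \<Rightarrow> 'a option pmf" where
  "choice_pmf H u =
     (if neighbors H u = {} then return_pmf None
      else map_pmf Some (pmf_of_set (neighbors H u)))"

text \<open>
  The coordinate \<open>(t, u)\<close> is the choice of \<open>u\<close> at time \<open>t\<close>.  Choices are drawn for all
  vertices at all times; those of uninformed vertices are never looked at.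
\<close>

definition push_space :: "'a ugraph \<Rightarrow> (nat \<times> 'a \<Rightarrow> 'a option) measure" where
  "push_space H = (\<Pi>\<^sub>M (t, u)\<in>UNIV \<times> verts H. measure_pmf (choice_pmf H u))"

primrec informed :: "'a \<Rightarrow> (nat \<times> 'a \<Rightarrow> 'a option) \<Rightarrow> nat \<Rightarrow> 'a set" where
  "informed v c 0 = {v}"
| "informed v c (Suc t) = informed v c t \<union> {w. \<exists>u\<in>informed v c t. c (t, u) = Some w}"

text \<open>
  The sequence \<open>informed\<close> is not stopped once every vertex is informed; this does not
  affect the first time at which that happens.  The infimum of the empty set is \<open>\<infinity>\<close>.
\<close>

definition runtime :: "'a ugraph \<Rightarrow> 'a \<Rightarrow> (nat \<times> 'a \<Rightarrow> 'a option) \<Rightarrow> enat" where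
  "runtime H v c = (INF t\<in>{t. informed v c t = verts H}. enat t)"

definition runtime_law :: "'a ugraph \<Rightarrow> 'a \<Rightarrow> enat measure" where
  "runtime_law H v = distr (push_space H) (count_space UNIV) (runtime H v)"

text \<open>First sample the percolated graph, then run the push protocol on it.\<close>

definition percolated_runtime_law :: "'a ugraph \<Rightarrow> real \<Rightarrow> 'a \<Rightarrow> enat measure" where
  "percolated_runtime_law G p v =
     measure_pmf (percolation G p) \<bind> (\<lambda>H. runtime_law H v)"


section \<open>Asymptotics in the number of vertices\<close>

text \<open>
  A family of \<open>d\<^sub>n\<close>-regular graphs on \<open>n\<close> vertices may be available only for some \<open>n\<close>
  (hypercubes, for instance), so limits as \<open>n \<rightarrow> \<infinity>\<close> are taken along an infinite set \<open>S\<close> of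
  admissible sizes; \<open>S = {1..}\<close> gives ordinary limits.
\<close>

definition sizes_at_top :: "nat set \<Rightarrow> nat filter" where
  "sizes_at_top S = inf sequentially (principal S)"

definition whp :: "nat set \<Rightarrow> (nat \<Rightarrow> 'b measure) \<Rightarrow> (nat \<Rightarrow> 'b \<Rightarrow> bool) \<Rightarrow> bool" where
  "whp S M P \<longleftrightarrow>
     ((\<lambda>n. measure (M n) {x \<in> space (M n). P n x}) \<longlongrightarrow> 1) (sizes_at_top S)"


section \<open>Well-definedness of the laws\<close>

lemma sizes_at_top_neq_bot:
  assumes "infinite S"
  shows "sizes_at_top S \<noteq> bot"
proof -
  have "\<exists>n\<ge>m. n \<in> S" for m
    using assms infinite_nat_iff_unbounded_le by auto
  then show ?thesis
    unfolding sizes_at_top_def trivial_limit_def eventually_inf_principal eventually_sequentially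
    by auto
qed

lemma prob_space_push_space: "prob_space (push_space H)"
  unfolding push_space_def
  by (rule prob_space_PiM) (auto intro: measure_pmf.prob_space_axioms)

lemma choice_measurable:
  assumes "u \<in> verts H"
  shows "(\<lambda>c. c (t, u)) \<in> push_space H \<rightarrow>\<^sub>M count_space UNIV"
proof -
  have "(\<lambda>c. c (t, u)) \<in> push_space H \<rightarrow>\<^sub>M
      (case (t, u) of (t, u) \<Rightarrow> measure_pmf (choice_pmf H u))"
    unfolding push_space_def by (rule measurable_component_singleton) (use assms in simp)
  then show ?thesis by simp
qed

lemma informed_Suc_eq_iff:
  "informed v c (Suc t) = A \<longleftrightarrow>
     (\<exists>B\<in>Pow A. informed v c t = B \<and> (\<forall>u\<in>B. c (t, u) \<in> insert None (Some ` A)) \<and>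
        (\<forall>w\<in>A - B. \<exists>u\<in>B. c (t, u) = Some w))"
proof -
  have *: "x \<in> insert None (Some ` A) \<longleftrightarrow> (\<forall>w. x = Some w \<longrightarrow> w \<in> A)" for x :: "'a option"
    by (cases x) auto
  show ?thesis
    unfolding * by auto
qed

lemma informed_measurable:
  assumes "finite (verts H)" "A \<subseteq> verts H"
  shows "Measurable.pred (push_space H) (\<lambda>c. informed v c t = A)"
  using assms(2)
proof (induction t arbitrary: A)
  case (Suc t)
  have fin: "finite A"
    using Suc.prems assms(1) finite_subset by blast
  have choice: "Measurable.pred (push_space H) (\<lambda>c. c (t, u) \<in> X)" if "u \<in> A" for u X
    using that Suc.prems by (intro pred_sets2[OF _ choice_measurable]) auto
  have choice_eq: "Measurable.pred (push_space H) (\<lambda>c. c (t, u) = x)" if "u \<in> A" for u x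
    using choice[OF that, of "{x}"] by simp
  have "Measurable.pred (push_space H) (\<lambda>c. \<exists>B\<in>Pow A. informed v c t = B \<and>
          (\<forall>u\<in>B. c (t, u) \<in> insert None (Some ` A)) \<and>
          (\<forall>w\<in>A - B. \<exists>u\<in>B. c (t, u) = Some w))"
  proof (rule pred_intros_finite(4))
    fix B assume "B \<in> Pow A"
    then have B: "B \<subseteq> A" by simp
    then have finB: "finite B" using fin finite_subset by blast
    have 1: "Measurable.pred (push_space H) (\<lambda>c. informed v c t = B)"
      using B Suc.prems by (intro Suc.IH) auto
    have 2: "Measurable.pred (push_space H) (\<lambda>c. \<forall>u\<in>B. c (t, u) \<in> insert None (Some ` A))"
      using finB B by (intro pred_intros_finite(3) choice) auto
    have 3: "Measurable.pred (push_space H) (\<lambda>c. \<forall>w\<in>A - B. \<exists>u\<in>B. c (t, u) = Some w)"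
      using finB fin B by (intro pred_intros_finite(3,4) choice_eq) auto
    show "Measurable.pred (push_space H) (\<lambda>c. informed v c t = B \<and>
          (\<forall>u\<in>B. c (t, u) \<in> insert None (Some ` A)) \<and>
          (\<forall>w\<in>A - B. \<exists>u\<in>B. c (t, u) = Some w))"
      by (intro pred_intros_logic 1 2 3)
  qed (use fin in simp)
  then show ?case
    unfolding informed_Suc_eq_iff .
qed simp

lemma runtime_measurable:
  assumes "finite (verts H)"
  shows "runtime H v \<in> push_space H \<rightarrow>\<^sub>M count_space UNIV"
proof -
  have [measurable]: "Measurable.pred (push_space H) (\<lambda>c. informed v c t = verts H)" for t
    using assms by (intro informed_measurable) auto
  have eq: "runtime H v = (\<lambda>c. if \<exists>t. informed v c t = verts H
      then enat (LEAST t. informed v c t = verts H) else \<infinity>)"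
  proof
    fix c
    show "runtime H v c = (if \<exists>t. informed v c t = verts H
      then enat (LEAST t. informed v c t = verts H) else \<infinity>)"
    proof (cases "\<exists>t. informed v c t = verts H")
      case True
      have "runtime H v c = enat (LEAST t. informed v c t = verts H)"
        unfolding runtime_def
      proof (rule antisym)
        show "(INF t\<in>{t. informed v c t = verts H}. enat t)
            \<le> enat (LEAST t. informed v c t = verts H)"
          by (rule INF_lower) (use LeastI_ex[OF True] in simp)
        show "enat (LEAST t. informed v c t = verts H)
            \<le> (INF t\<in>{t. informed v c t = verts H}. enat t)"
          by (rule INF_greatest) (simp add: Least_le)
      qed
      with True show ?thesis by simp
    qed (simp add: runtime_def top_enat_def)
  qed
  show ?thesis
    unfolding eq by measurable
qed

lemma prob_space_runtime_law:
  assumes "finite (verts H)"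
  shows "prob_space (runtime_law H v)"
  unfolding runtime_law_def
  by (intro prob_space.prob_space_distr prob_space_push_space runtime_measurable assms)

lemma runtime_law_kernel:
  "(\<lambda>H. runtime_law H v) \<in> measure_pmf P \<rightarrow>\<^sub>M subprob_algebra (count_space UNIV)"
proof -
  have "subprob_space (runtime_law H v)" for H
  proof
    have "emeasure (push_space H) X \<le> 1" for X
      by (rule prob_space.measure_le_1[OF prob_space_push_space])
    then show "emeasure (runtime_law H v) (space (runtime_law H v)) \<le> 1"
      by (simp add: runtime_law_def distr_def emeasure_measure_of_conv)
  qed (simp add: runtime_law_def)
  then show ?thesis
    by (auto simp: space_subprob_algebra runtime_law_def)
qed

lemma measure_percolated_runtime_law:
  "measure (percolated_runtime_law G p v) A =
     measure_pmf.expectation (percolation G p) (\<lambda>H. measure (runtime_law H v) A)"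
  unfolding percolated_runtime_law_def
  by (intro measure_pmf.measure_bind[OF runtime_law_kernel]) simp

lemma verts_percolation: "H \<in> set_pmf (percolation G p) \<Longrightarrow> verts H = verts G"
  by (auto simp: percolation_def)

lemma prob_space_percolated_runtime_law:
  assumes "finite (verts G)"
  shows "prob_space (percolated_runtime_law G p v)"
  unfolding percolated_runtime_law_def
  by (intro measure_pmf.prob_space_bind[OF _ runtime_law_kernel] AE_pmfI prob_space_runtime_law)
     (simp add: verts_percolation assms)

end

theory Submission
  imports Defs
begin

text \<open>
  Write the push protocol as a sequence of single pushes and keep the percolated edges hidden.
  Given the history, the hidden edge set \<open>F\<close> has weight proportional to its prior times
  a product of factors \<open>1 / deg\<^sub>F u\<close>, one for each push made so far. No push has
  used an edge from an informed \<open>u\<close> to an uninformed \<open>w\<close>, so adding that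
  edge changes the weight only through the at most \<open>T\<close> pushes of \<open>u\<close>, that is, by a factor
  close to \<open>1\<close> because \<open>T = o(p d)\<close>. Hence, unless the history makes irregular degrees likely,
  \<open>u\<close> pushes to \<open>w\<close> with conditional probability at least \<open>(1 - \<Delta>) / d\<close>, and the
  percolated protocol dominates the push protocol on \<open>G\<close> in which every push is lost
  with probability \<open>\<Delta>\<close>.

  The lossy protocol is compared with the lossless one through local clocks: an informed vertex
  carries a time on the lossless time axis, which advances at every push that is not lost and is
  passed on to the receiver. Advancing a clock does not increase the probability that the lossless protocol,
  continued from the current clock values, misses some vertex at time \<open>T\<close>. The expectation of the sum of
  \<open>y\<close> to the power of the clocks shrinks by the factor \<open>\<Delta> + 2 y\<close> per round, so for small
  \<open>\<Delta>\<close> all clocks reach \<open>T\<close> within \<open>(1 + \<epsilon>) T\<close> rounds.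
  Irregular degrees are excluded by a Chernoff bound and \<open>n \<le> 2\<^sup>T\<close>, as the
  informed set at most doubles in a round.
\<close>

section \<open>Finitely many choices\<close>

lemma finite_neighbors:
  assumes "simple_graph H"
  shows "finite (neighbors H u)" "neighbors H u \<subseteq> verts H"
proof -
  show "neighbors H u \<subseteq> verts H"
    using assms by (auto simp: simple_graph_def neighbors_def)
  then show "finite (neighbors H u)"
    using assms finite_subset by (auto simp: simple_graph_def)
qed

lemma set_choice_pmf:
  assumes "simple_graph H"
  shows "set_pmf (choice_pmf H u) \<subseteq> insert None (Some ` neighbors H u)"
  using assms by (auto simp: choice_pmf_def finite_neighbors)

lemma finite_set_choice_pmf:
  assumes "simple_graph H"
  shows "finite (set_pmf (choice_pmf H u))"
  using finite_subset[OF set_choice_pmf[OF assms]] finite_neighbors(1)[OF assms] by blast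

lemma expectation_Pi_pmf_insert:
  fixes f :: "_ \<Rightarrow> real"
  assumes "finite A" "x \<notin> A" "finite (set_pmf (p x))" "\<And>y. y \<in> A \<Longrightarrow> finite (set_pmf (p y))"
  shows "measure_pmf.expectation (Pi_pmf (insert x A) dflt p) f =
    measure_pmf.expectation (p x) (\<lambda>y. measure_pmf.expectation (Pi_pmf A dflt p) (\<lambda>g. f (g(x := y))))"
proof -
  have fin: "finite (set_pmf (Pi_pmf A dflt p))"
    using assms by (simp add: set_Pi_pmf finite_PiE_dflt)
  have "Pi_pmf (insert x A) dflt p = p x \<bind> (\<lambda>y. map_pmf (\<lambda>g. g(x := y)) (Pi_pmf A dflt p))"
    using assms by (simp add: Pi_pmf_insert' map_pmf_def)
  also have "measure_pmf.expectation \<dots> f =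
      (\<Sum>y\<in>set_pmf (p x). pmf (p x) y *\<^sub>R measure_pmf.expectation (map_pmf (\<lambda>g. g(x := y)) (Pi_pmf A dflt p)) f)"
    using assms fin by (intro pmf_expectation_bind) auto
  also have "\<dots> = measure_pmf.expectation (p x) (\<lambda>y. measure_pmf.expectation (Pi_pmf A dflt p) (\<lambda>g. f (g(x := y))))"
    using assms by (subst integral_measure_pmf[where A="set_pmf (p x)"]) auto
  finally show ?thesis .
qed

lemma informed_mono: "s \<le> t \<Longrightarrow> informed v c s \<subseteq> informed v c t"
  by (induction rule: dec_induct) auto

text \<open>Choices of \<open>c'\<close> that stay in \<open>V\<close> keep its informed sets in
  \<open>V\<close>, so only coordinates \<open>(s, u)\<close> with \<open>s < t\<close> and
  \<open>u \<in> V\<close> are ever read. Applied with \<open>c = c'\<close>, it yields just the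
  containment.\<close>

lemma informed_cong:
  assumes "\<And>s u. s < t \<Longrightarrow> u \<in> V \<Longrightarrow> c (s, u) = c' (s, u)"
    and "\<And>s u w. s < t \<Longrightarrow> u \<in> V \<Longrightarrow> c' (s, u) = Some w \<Longrightarrow> w \<in> V" "v \<in> V"
  shows "informed v c t = informed v c' t \<and> informed v c' t \<subseteq> V"
  using assms
proof (induction t)
  case (Suc t)
  have "informed v c t = informed v c' t \<and> informed v c' t \<subseteq> V"
    by (rule Suc.IH) (use Suc.prems less_SucI in blast)+
  then have IH: "informed v c t = informed v c' t" "informed v c' t \<subseteq> V" by auto
  have "c (t, u) = c' (t, u)" if "u \<in> informed v c' t" for u
    using IH that Suc.prems(1)[of t u] by auto
  moreover have "w \<in> V" if "u \<in> informed v c' t" "c' (t, u) = Some w" for u w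
    using IH that Suc.prems(2)[of t u w] by auto
  ultimately show ?case using IH by auto
qed auto

section \<open>From the infinite product of choices to finitely many rounds\<close>

lemma measure_push_space_box:
  assumes "finite J" "J \<subseteq> UNIV \<times> verts H"
  shows "{c \<in> space (push_space H). \<forall>j\<in>J. c j = f j} \<in> sets (push_space H)"
    and "measure (push_space H) {c \<in> space (push_space H). \<forall>j\<in>J. c j = f j}
       = (\<Prod>j\<in>J. pmf (choice_pmf H (snd j)) (f j))"
proof -
  define M where "M = (\<lambda>j :: nat \<times> 'a. measure_pmf (choice_pmf H (snd j)))"
  interpret product_prob_space M "UNIV \<times> verts H"
    unfolding M_def by unfold_locales
  have eq: "push_space H = PiM (UNIV \<times> verts H) M"
    by (simp add: push_space_def M_def case_prod_unfold)
  have s: "{c \<in> space (push_space H). \<forall>j\<in>J. c j = f j} = prod_emb (UNIV \<times> verts H) M J (PiE J (\<lambda>j. {f j}))"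
    using assms unfolding eq prod_emb_def by (auto simp: space_PiM PiE_iff M_def restrict_def extensional_def)
  show "{c \<in> space (push_space H). \<forall>j\<in>J. c j = f j} \<in> sets (push_space H)"
    unfolding s unfolding eq using assms by (intro sets_PiM_I) (auto simp: M_def)
  show "measure (push_space H) {c \<in> space (push_space H). \<forall>j\<in>J. c j = f j}
       = (\<Prod>j\<in>J. pmf (choice_pmf H (snd j)) (f j))"
    unfolding s unfolding eq using assms
    by (subst measure_PiM_emb) (auto simp: M_def measure_pmf_single)
qed

text \<open>The boxes \<open>B f\<close>, on which the choices in \<open>J\<close> agree with
  \<open>f\<close>, are disjoint for different \<open>f\<close> in the support and have mass
  \<open>pmf P f\<close>, so together they cover almost everything. By \<open>dep\<close> the event
  \<open>Q\<close> is constant on each box. Asking for \<open>dep\<close> only on the support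
  matters later, because only there are all chosen vertices neighbors.\<close>

lemma measure_push_space_eq_Pi_pmf:
  assumes H: "simple_graph H" and J: "finite J" "J \<subseteq> UNIV \<times> verts H"
    and Q: "{c \<in> space (push_space H). Q c} \<in> sets (push_space H)"
    and dep: "\<And>c f. f \<in> set_pmf (Pi_pmf J None (\<lambda>j. choice_pmf H (snd j))) \<Longrightarrow>
       (\<And>j. j \<in> J \<Longrightarrow> c j = f j) \<Longrightarrow> Q c = Q f"
  shows "measure (push_space H) {c \<in> space (push_space H). Q c}
    = measure_pmf.prob (Pi_pmf J None (\<lambda>j. choice_pmf H (snd j))) {f. Q f}"
proof -
  interpret prob_space "push_space H" by (rule prob_space_push_space)
  define P where "P = Pi_pmf J None (\<lambda>j. choice_pmf H (snd j))"
  define B where "B f = {c \<in> space (push_space H). \<forall>j\<in>J. c j = f j}" for f :: "nat \<times> 'a \<Rightarrow> 'a option"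
  have sB: "B f \<in> events" for f
    unfolding B_def by (rule measure_push_space_box[OF J])
  have fin: "finite (set_pmf P)"
    unfolding P_def using J H by (simp add: set_Pi_pmf finite_PiE_dflt finite_set_choice_pmf)
  have none: "f x = None" if "f \<in> set_pmf P" "x \<notin> J" for f x
    using subsetD[OF set_Pi_pmf_subset[OF J(1)] that(1)[unfolded P_def]] that(2) by (cases x) simp
  have pB: "prob (B f) = pmf P f" if "f \<in> set_pmf P" for f
  proof -
    have "\<forall>x. x \<notin> J \<longrightarrow> f x = None"
      using none[OF that] by simp
    then show ?thesis
      unfolding B_def P_def using J by (simp add: measure_push_space_box pmf_Pi)
  qed
  \<comment> \<open>Functions in the support are \<open>None\<close> off \<open>J\<close>, so
    agreement on \<open>J\<close> makes them equal.\<close>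
  have disj: "disjoint_family_on B (set_pmf P)"
  proof (unfold disjoint_family_on_def, intro ballI impI, rule ccontr)
    fix f g assume fg: "f \<in> set_pmf P" "g \<in> set_pmf P" "f \<noteq> g" "B f \<inter> B g \<noteq> {}"
    have "f x = None" "g x = None" if "x \<notin> J" for x
      using that fg none by simp_all
    moreover have "f x = g x" if "x \<in> J" for x
      using fg(4) that by (auto simp: B_def)
    ultimately have "f = g" by (metis ext)
    with fg show False by simp
  qed
  have sum: "prob (\<Union>f\<in>A. B f) = measure_pmf.prob P A" if "A \<subseteq> set_pmf P" for A
  proof -
    have "finite A" using that fin finite_subset by blast
    moreover have "disjoint_family_on B A"
      using disj that by (auto simp: disjoint_family_on_def)
    ultimately have "prob (\<Union>f\<in>A. B f) = (\<Sum>f\<in>A. prob (B f))"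
      using sB by (intro finite_measure_finite_Union) auto
    also have "\<dots> = (\<Sum>f\<in>A. pmf P f)" using that pB by (intro sum.cong) auto
    also have "\<dots> = measure_pmf.prob P A"
      using \<open>finite A\<close> by (simp add: measure_measure_pmf_finite)
    finally show ?thesis .
  qed
  have one: "prob (\<Union>f\<in>set_pmf P. B f) = 1"
    by (simp add: sum measure_pmf.prob_eq_1 AE_measure_pmf)
  have ae: "AE c in push_space H. c \<in> (\<Union>f\<in>set_pmf P. B f)"
    using one fin sB by (subst (asm) prob_eq_1) auto
  have "prob {c \<in> space (push_space H). Q c} = prob (\<Union>f\<in>{f \<in> set_pmf P. Q f}. B f)"
  proof (rule measure_eq_AE)
    show "AE c in push_space H. (c \<in> {c \<in> space (push_space H). Q c}) = (c \<in> (\<Union>f\<in>{f \<in> set_pmf P. Q f}. B f))"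
      using ae by eventually_elim (auto simp: B_def P_def dest: dep)
    show "(\<Union>f\<in>{f \<in> set_pmf P. Q f}. B f) \<in> events"
      using fin sB by (intro sets.finite_UN) auto
  qed (fact Q)
  also have "\<dots> = measure_pmf.prob P {f \<in> set_pmf P. Q f}"
    by (rule sum) auto
  also have "\<dots> = measure_pmf.prob P {f. Q f}"
    by (rule measure_prob_cong_0) (auto simp: set_pmf_eq)
  finally show ?thesis unfolding P_def .
qed

text \<open>Informed sets only grow, so under the containment a set that has filled
  \<open>verts H\<close> by time \<open>t\<close> is still equal to it at time
  \<open>t\<close>.\<close>

lemma runtime_le_iff:
  assumes "informed v c t \<subseteq> verts H"
  shows "runtime H v c \<le> enat t \<longleftrightarrow> informed v c t = verts H"
proof -
  have "runtime H v c \<le> enat t \<longleftrightarrow> (\<exists>s. informed v c s = verts H \<and> s \<le> t)"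
  proof
    assume le: "runtime H v c \<le> enat t"
    have ne: "enat ` {s. informed v c s = verts H} \<noteq> {}"
    proof
      assume "enat ` {s. informed v c s = verts H} = {}"
      then have "runtime H v c = \<infinity>" unfolding runtime_def by (simp add: top_enat_def)
      with le show False by simp
    qed
    then have "Inf (enat ` {s. informed v c s = verts H}) \<in> enat ` {s. informed v c s = verts H}"
      by (metis Inf_enat_def LeastI ex_in_conv)
    with le show "\<exists>s. informed v c s = verts H \<and> s \<le> t"
      unfolding runtime_def by auto
  next
    assume "\<exists>s. informed v c s = verts H \<and> s \<le> t"
    then obtain s where s: "informed v c s = verts H" "s \<le> t" by auto
    then have "runtime H v c \<le> enat s" unfolding runtime_def by (intro INF_lower) auto
    with s show "runtime H v c \<le> enat t" by (meson enat_ord_simps(1) order_trans)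
  qed
  also have "\<dots> \<longleftrightarrow> informed v c t = verts H"
    using informed_mono[of _ t v c] assms by fastforce
  finally show ?thesis .
qed

lemma ereal_of_enat_le_iff_floor:
  assumes "x \<ge> 0"
  shows "ereal_of_enat \<tau> \<le> ereal x \<longleftrightarrow> \<tau> \<le> enat (nat \<lfloor>x\<rfloor>)"
proof (cases \<tau>)
  case (enat k)
  have "real k \<le> x \<longleftrightarrow> k \<le> nat \<lfloor>x\<rfloor>"
    using assms by linarith
  with enat show ?thesis by simp
qed simp

definition push_choices :: "'a ugraph \<Rightarrow> nat \<Rightarrow> (nat \<times> 'a \<Rightarrow> 'a option) pmf" where
  "push_choices H t = Pi_pmf ({..<t} \<times> verts H) None (\<lambda>j. choice_pmf H (snd j))"

lemma push_choices_neighbors: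
  assumes "simple_graph H" "c \<in> set_pmf (push_choices H t)" "c (s, u) = Some w"
  shows "w \<in> neighbors H u"
proof -
  have "finite ({..<t} \<times> verts H)" using assms(1) by (simp add: simple_graph_def)
  from assms(2)[unfolded push_choices_def set_Pi_pmf[OF this]] assms(3)
  have "c (s, u) \<in> set_pmf (choice_pmf H u)"
    by (simp add: PiE_dflt_def) (metis option.distinct(1))
  with assms(3) set_choice_pmf[OF assms(1)] show ?thesis by fastforce
qed

lemma push_choices_verts:
  assumes "simple_graph H" "c \<in> set_pmf (push_choices H t)" "c (s, u) = Some w"
  shows "w \<in> verts H"
  using push_choices_neighbors[OF assms] finite_neighbors(2)[OF assms(1)] by blast

text \<open>The runtime is integer valued, so only \<open>nat \<lfloor>x\<rfloor>\<close> counts,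
  and whether everything is informed by then is decided by the choices made before that
  time.\<close>

lemma measure_runtime_law:
  assumes H: "simple_graph H" and v: "v \<in> verts H" and x: "x \<ge> 0"
  shows "measure (runtime_law H v) {\<tau> \<in> space (runtime_law H v). ereal_of_enat \<tau> \<le> ereal x}
    = measure_pmf.prob (push_choices H (nat \<lfloor>x\<rfloor>)) {c. informed v c (nat \<lfloor>x\<rfloor>) = verts H}"
proof -
  define t where "t = nat \<lfloor>x\<rfloor>"
  have fin: "finite (verts H)" using H by (simp add: simple_graph_def)
  have rm: "runtime H v \<in> push_space H \<rightarrow>\<^sub>M count_space UNIV" by (rule runtime_measurable[OF fin])
  have "measure (runtime_law H v) {\<tau> \<in> space (runtime_law H v). ereal_of_enat \<tau> \<le> ereal x}
    = measure (push_space H) {c \<in> space (push_space H). runtime H v c \<le> enat t}"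
    unfolding runtime_law_def t_def
    by (subst measure_distr[OF rm])
       (auto simp: ereal_of_enat_le_iff_floor[OF x] intro!: arg_cong[where f="measure _"])
  also have "\<dots> = measure_pmf.prob (push_choices H t) {c. runtime H v c \<le> enat t}"
    unfolding push_choices_def
  proof (rule measure_push_space_eq_Pi_pmf[OF H])
    show "{c \<in> space (push_space H). runtime H v c \<le> enat t} \<in> sets (push_space H)"
      using measurable_sets[OF rm, of "{..enat t}"] by (simp add: vimage_def Int_def conj_commute)
    fix c f
    assume f: "f \<in> set_pmf (Pi_pmf ({..<t} \<times> verts H) None (\<lambda>j. choice_pmf H (snd j)))"
      and eq: "\<And>j. j \<in> {..<t} \<times> verts H \<Longrightarrow> c j = f j"
    have "informed v c t = informed v f t \<and> informed v f t \<subseteq> verts H"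
      by (rule informed_cong)
         (use eq v push_choices_verts[OF H f[folded push_choices_def]] in auto)
    then show "(runtime H v c \<le> enat t) = (runtime H v f \<le> enat t)"
      by (simp add: runtime_le_iff)
  qed (use fin in auto)
  \<comment> \<open>On the support the informed set stays inside \<open>verts H\<close>, so that
    \<open>runtime_le_iff\<close> applies and the two events agree there.\<close>
  also have "\<dots> = measure_pmf.prob (push_choices H t) {c. informed v c t = verts H}"
  proof (rule measure_prob_cong_0)
    fix f assume *: "f \<in> {c. runtime H v c \<le> enat t} - {c. informed v c t = verts H}"
    { assume f: "f \<in> set_pmf (push_choices H t)"
      have "informed v f t = informed v f t \<and> informed v f t \<subseteq> verts H"
        by (rule informed_cong)
           (use v push_choices_verts[OF H f] in auto)
      with * have False by (simp add: runtime_le_iff) }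
    then show "pmf (push_choices H t) f = 0" by (auto simp: set_pmf_eq)
  next
    fix f assume "f \<in> {c. informed v c t = verts H} - {c. runtime H v c \<le> enat t}"
    then have "informed v f t = verts H" "\<not> runtime H v f \<le> enat t" by auto
    then show "pmf (push_choices H t) f = 0" using runtime_le_iff[of v f t H] by simp
  qed
  finally show ?thesis unfolding t_def .
qed

section \<open>Pushing one vertex at a time\<close>

text \<open>Fixes the order of the turns within a round. It may be arbitrary, since the set informed
  at the start of the round decides who pushes.\<close>

definition enum_list :: "'a set \<Rightarrow> 'a list" where
  "enum_list I = (SOME xs. set xs = I \<and> distinct xs)"

lemma enum_list: "finite I \<Longrightarrow> set (enum_list I) = I \<and> distinct (enum_list I)"
  unfolding enum_list_def by (rule someI_ex) (metis finite_distinct_list)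

text \<open>
  The probability that some vertex of \<open>V\<close> is still uninformed when the current round is finished
  and \<open>r\<close> more rounds are made. \<open>A\<close> is the informed set at the start of the current round,
  \<open>us\<close> lists the vertices whose turn in this round is still to come, and \<open>E u\<close> takes the
  expectation over a push of \<open>u\<close>.
\<close>

fun push_fail :: "('a \<Rightarrow> ('a option \<Rightarrow> real) \<Rightarrow> real) \<Rightarrow> 'a set \<Rightarrow> nat \<Rightarrow> 'a list \<Rightarrow> 'a set \<Rightarrow> 'a set \<Rightarrow> real" where
  "push_fail E V 0 [] A I = (if I = V then 0 else 1)"
| "push_fail E V (Suc r) [] A I = push_fail E V r (enum_list V) I I"
| "push_fail E V r (u # us) A I =
    (if u \<in> A then E u (\<lambda>x. push_fail E V r us A (I \<union> set_option x)) else push_fail E V r us A I)"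

text \<open>The dynamics of \<open>informed\<close>, unfolded from the first round on, which is the
  direction of the recursion in \<open>push_fail\<close>.\<close>

fun informed_after :: "(nat \<times> 'a \<Rightarrow> 'a option) \<Rightarrow> nat \<Rightarrow> nat \<Rightarrow> 'a set \<Rightarrow> 'a set" where
  "informed_after c t 0 I = I"
| "informed_after c t (Suc r) I = informed_after c (Suc t) r (I \<union> {w. \<exists>u\<in>I. c (t, u) = Some w})"

lemma informed_add: "informed v c (t + r) = informed_after c t r (informed v c t)"
  by (induction r arbitrary: t) (simp_all flip: informed.simps(2) add_Suc)

lemma informed_after_upd:
  "s < t \<Longrightarrow> informed_after (c((s, u) := x)) t r I = informed_after c t r I"
  by (induction r arbitrary: t I) simp_all

definition choice_exp :: "'a ugraph \<Rightarrow> 'a \<Rightarrow> ('a option \<Rightarrow> real) \<Rightarrow> real" where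
  "choice_exp H u f = measure_pmf.expectation (choice_pmf H u) f"

text \<open>Induction along \<open>push_fail\<close>, revealing one choice at a time.
  \<open>J\<close> holds the coordinates that are still hidden, and a push of \<open>u\<close>
  integrates out \<open>(t, u)\<close>. \<open>J\<close> may contain more than will be read, because
  the turn of a vertex outside \<open>A\<close> is skipped without removing its coordinate.\<close>

lemma expectation_informed_after:
  assumes H: "simple_graph H"
  assumes "finite J" "{t} \<times> set us \<subseteq> J" "{t<..t + r} \<times> verts H \<subseteq> J"
    and "distinct us" "set us \<subseteq> verts H" "I \<subseteq> verts H"
  shows "measure_pmf.expectation (Pi_pmf J None (\<lambda>j. choice_pmf H (snd j)))
      (\<lambda>c. of_bool (informed_after c (Suc t) r (I \<union> {w. \<exists>u\<in>set us \<inter> A. c (t, u) = Some w}) \<noteq> verts H))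
    = push_fail (choice_exp H) (verts H) r us A I"
  using assms(2-)
proof (induction "choice_exp H" "verts H" r us A I arbitrary: t J rule: push_fail.induct)
  case (1 A I)
  then show ?case by simp
next
  case (2 r A I)
  have fin: "finite (verts H)" using H by (auto simp: simple_graph_def)
  have "measure_pmf.expectation (Pi_pmf J None (\<lambda>j. choice_pmf H (snd j)))
      (\<lambda>c. of_bool (informed_after c (Suc (Suc t)) r (I \<union> {w. \<exists>u\<in>set (enum_list (verts H)) \<inter> I. c (Suc t, u) = Some w}) \<noteq> verts H))
    = push_fail (choice_exp H) (verts H) r (enum_list (verts H)) I I"
    by (rule 2(1)) (use 2 enum_list[OF fin] in auto)
  moreover have "verts H \<inter> I = I" using 2 by auto
  ultimately show ?case using enum_list[OF fin] by simp
next
  case (3 r u us A I)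
  show ?case
  proof (cases "u \<in> A")
    case False
    have "measure_pmf.expectation (Pi_pmf J None (\<lambda>j. choice_pmf H (snd j)))
      (\<lambda>c. of_bool (informed_after c (Suc t) r (I \<union> {w. \<exists>u\<in>set us \<inter> A. c (t, u) = Some w}) \<noteq> verts H))
    = push_fail (choice_exp H) (verts H) r us A I"
      by (rule 3(2)) (use 3 False in auto)
    with False show ?thesis by simp
  next
    case True
    define K where "K = J - {(t, u)}"
    have J: "J = insert (t, u) K" "(t, u) \<notin> K" "finite K"
      using 3 by (auto simp: K_def)
    \<comment> \<open>\<open>u\<close> does not occur in \<open>us\<close> and later rounds read
      later times, so fixing the choice at \<open>(t, u)\<close> only adds its receiver to
      \<open>I\<close>.\<close>
    have *: "informed_after (c((t, u) := x)) (Suc t) r (I \<union> {w. \<exists>u'\<in>set (u # us) \<inter> A. (c((t, u) := x)) (t, u') = Some w})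
      = informed_after c (Suc t) r ((I \<union> set_option x) \<union> {w. \<exists>u\<in>set us \<inter> A. c (t, u) = Some w})" for c x
    proof -
      have "(c((t, u) := x)) (t, u') = c (t, u')" if "u' \<in> set us" for u'
        using 3(6) that by auto
      then have "{w. \<exists>u'\<in>set (u # us) \<inter> A. (c((t, u) := x)) (t, u') = Some w}
        = set_option x \<union> {w. \<exists>u\<in>set us \<inter> A. c (t, u) = Some w}"
        using True by (auto simp del: fun_upd_apply simp: fun_upd_same)
      then show ?thesis by (simp add: informed_after_upd Un_assoc del: fun_upd_apply)
    qed
    have IH: "measure_pmf.expectation (Pi_pmf K None (\<lambda>j. choice_pmf H (snd j)))
        (\<lambda>c. of_bool (informed_after c (Suc t) r ((I \<union> set_option x) \<union> {w. \<exists>u\<in>set us \<inter> A. c (t, u) = Some w}) \<noteq> verts H))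
      = push_fail (choice_exp H) (verts H) r us A (I \<union> set_option x)" if "x \<in> set_pmf (choice_pmf H u)" for x
    proof (rule 3(1)[OF True])
      show "I \<union> set_option x \<subseteq> verts H"
        using that 3 set_choice_pmf[OF H, of u] finite_neighbors(2)[OF H, of u] by auto
    qed (use 3 in \<open>auto simp: K_def\<close>)
    have "measure_pmf.expectation (Pi_pmf J None (\<lambda>j. choice_pmf H (snd j)))
        (\<lambda>c. of_bool (informed_after c (Suc t) r (I \<union> {w. \<exists>u\<in>set (u # us) \<inter> A. c (t, u) = Some w}) \<noteq> verts H))
      = measure_pmf.expectation (choice_pmf H u) (\<lambda>x. measure_pmf.expectation (Pi_pmf K None (\<lambda>j. choice_pmf H (snd j)))
        (\<lambda>c. of_bool (informed_after c (Suc t) r ((I \<union> set_option x) \<union> {w. \<exists>u\<in>set us \<inter> A. c (t, u) = Some w}) \<noteq> verts H) :: real))"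
    proof -
      have fin: "finite (set_pmf (choice_pmf H (snd j)))" for j :: "nat \<times> 'a"
        by (rule finite_set_choice_pmf[OF H])
      show ?thesis
        unfolding J(1) expectation_Pi_pmf_insert[where p="\<lambda>j. choice_pmf H (snd j)", OF J(3,2) fin fin] * snd_conv ..
    qed
    also have "\<dots> = choice_exp H u (\<lambda>x. push_fail (choice_exp H) (verts H) r us A (I \<union> set_option x))"
      unfolding choice_exp_def[of H u] using IH
      by (intro integral_cong_AE) (auto simp: AE_measure_pmf_iff)
    finally show ?thesis using True by simp
  qed
qed

text \<open>The state with list \<open>[]\<close> and \<open>A = I = {v}\<close> is the end of an
  imaginary round before time \<open>0\<close>, so exactly \<open>t\<close> rounds remain.\<close>

lemma prob_push_choices:
  assumes H: "simple_graph H" and v: "v \<in> verts H"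
  shows "measure_pmf.prob (push_choices H t) {c. informed v c t = verts H}
    = 1 - push_fail (choice_exp H) (verts H) t [] {v} {v}"
proof (cases t)
  case 0
  then show ?thesis by simp
next
  case (Suc r)
  have fin: "finite (verts H)" using H by (simp add: simple_graph_def)
  have Hv: "verts H \<inter> {v} = {v}" using v by auto
  have "push_fail (choice_exp H) (verts H) t [] {v} {v} = push_fail (choice_exp H) (verts H) r (enum_list (verts H)) {v} {v}"
    using Suc by simp
  also have "\<dots> = measure_pmf.expectation (push_choices H t)
      (\<lambda>c. of_bool (informed_after c (Suc 0) r ({v} \<union> {w. \<exists>u\<in>set (enum_list (verts H)) \<inter> {v}. c (0, u) = Some w}) \<noteq> verts H))"
    unfolding push_choices_def
    by (rule expectation_informed_after[symmetric, OF H])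
       (use fin v Suc enum_list[OF fin] in auto)
  also have "\<dots> = measure_pmf.expectation (push_choices H t) (indicator {c. informed v c t \<noteq> verts H})"
    using informed_add[of v _ 0 t] enum_list[OF fin] Suc Hv
    by (intro arg_cong[where f="measure_pmf.expectation _"]) (auto simp: fun_eq_iff indicator_def)
  also have "\<dots> = measure_pmf.prob (push_choices H t) {c. informed v c t \<noteq> verts H}"
    by simp
  also have "\<dots> = 1 - measure_pmf.prob (push_choices H t) {c. informed v c t = verts H}"
    using measure_pmf.prob_compl[of "{c. informed v c t = verts H}" "push_choices H t"]
    by (simp add: Compl_eq_Diff_UNIV[symmetric] Compl_eq)
  finally show ?thesis by simp
qed

section \<open>Lossy push\<close>

lemma choice_exp_eq:
  assumes "simple_graph H"
  shows "choice_exp H u f = (if neighbors H u = {} then f None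
    else (\<Sum>w\<in>neighbors H u. f (Some w)) / card (neighbors H u))"
  using finite_neighbors(1)[OF assms, of u]
  by (simp add: choice_exp_def choice_pmf_def integral_pmf_of_set)

text \<open>Here \<open>None\<close> is a lost push, whereas in \<open>choice_exp\<close> it marks
  an isolated vertex. Both leave the informed set unchanged.\<close>

definition lossy_exp :: "'a ugraph \<Rightarrow> real \<Rightarrow> 'a \<Rightarrow> ('a option \<Rightarrow> real) \<Rightarrow> real" where
  "lossy_exp G \<Delta> u f = \<Delta> * f None + (1 - \<Delta>) * (\<Sum>w\<in>neighbors G u. f (Some w)) / card (neighbors G u)"

lemma lossy_exp_mono:
  assumes "0 \<le> \<Delta>" "\<Delta> \<le> 1" "f None \<le> g None" "\<And>w. w \<in> neighbors G u \<Longrightarrow> f (Some w) \<le> g (Some w)"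
  shows "lossy_exp G \<Delta> u f \<le> lossy_exp G \<Delta> u g"
  unfolding lossy_exp_def using assms
  by (intro add_mono mult_left_mono divide_right_mono sum_mono) auto

lemma lossy_exp_const:
  assumes "neighbors G u \<noteq> {}" "finite (neighbors G u)"
  shows "lossy_exp G \<Delta> u (\<lambda>_. a) = a"
  using assms by (simp add: lossy_exp_def) (simp add: algebra_simps)

lemma push_fail_lossy_bounds:
  assumes G: "simple_graph G" and D: "0 \<le> \<Delta>" "\<Delta> \<le> 1" and d: "\<And>u. u \<in> verts G \<Longrightarrow> neighbors G u \<noteq> {}"
    and "set us \<subseteq> verts G"
  shows "0 \<le> push_fail (lossy_exp G \<Delta>) (verts G) r us A I \<and> push_fail (lossy_exp G \<Delta>) (verts G) r us A I \<le> 1"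
  using assms(5)
proof (induction "lossy_exp G \<Delta>" "verts G" r us A I rule: push_fail.induct)
  case (2 r A I)
  then show ?case using enum_list[of "verts G"] G by (simp add: simple_graph_def)
next
  case (3 r u us A I)
  show ?case
  proof (cases "u \<in> A")
    case True
    note IH = 3(1)[OF True]
    have nb: "neighbors G u \<noteq> {}" "finite (neighbors G u)" using d 3 finite_neighbors[OF G] by auto
    define f where "f = (\<lambda>x. push_fail (lossy_exp G \<Delta>) (verts G) r us A (I \<union> set_option x))"
    have f: "0 \<le> f x" "f x \<le> 1" for x
      using IH[of x] 3 by (auto simp: f_def)
    have "lossy_exp G \<Delta> u (\<lambda>_. 0) \<le> lossy_exp G \<Delta> u f" "lossy_exp G \<Delta> u f \<le> lossy_exp G \<Delta> u (\<lambda>_. 1)"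
      by (intro lossy_exp_mono D f)+
    then show ?thesis using True by (simp add: lossy_exp_const[OF nb] f_def)
  qed (use 3 in auto)
qed auto

lemma push_fail_choice_bounds:
  assumes H: "simple_graph H" and "set us \<subseteq> verts H"
  shows "0 \<le> push_fail (choice_exp H) (verts H) r us A I \<and> push_fail (choice_exp H) (verts H) r us A I \<le> 1"
  using assms(2)
proof (induction "choice_exp H" "verts H" r us A I rule: push_fail.induct)
  case (2 r A I)
  then show ?case using enum_list[of "verts H"] H by (simp add: simple_graph_def)
next
  case (3 r u us A I)
  show ?case
  proof (cases "u \<in> A")
    case True
    note IH = 3(1)[OF True]
    let ?f = "\<lambda>x. push_fail (choice_exp H) (verts H) r us A (I \<union> set_option x)"
    have int: "integrable (measure_pmf (choice_pmf H u)) ?f"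
      by (intro integrable_measure_pmf_finite finite_set_choice_pmf H)
    have "0 \<le> choice_exp H u ?f"
      unfolding choice_exp_def[of H u] using IH 3 by (intro integral_nonneg_AE) auto
    moreover have "choice_exp H u ?f \<le> measure_pmf.expectation (choice_pmf H u) (\<lambda>_. 1)"
      unfolding choice_exp_def[of H u] using IH 3 int by (intro integral_mono) auto
    ultimately show ?thesis using True by simp
  qed (use 3 in auto)
qed auto

text \<open>A push can only enlarge the informed set. A turn taken by the larger state alone is
  compared with idling, because averaging a constant over a push returns that constant. The bound on
  \<open>I'\<close> makes the final test \<open>I = V\<close> monotone.\<close>

lemma push_fail_lossy_antimono:
  assumes G: "simple_graph G" and D: "0 \<le> \<Delta>" "\<Delta> \<le> 1" and d: "\<And>u. u \<in> verts G \<Longrightarrow> neighbors G u \<noteq> {}"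
    and "set us \<subseteq> verts G" "A \<subseteq> A'" "I \<subseteq> I'" "I' \<subseteq> verts G"
  shows "push_fail (lossy_exp G \<Delta>) (verts G) r us A' I' \<le> push_fail (lossy_exp G \<Delta>) (verts G) r us A I"
  using assms(5-)
proof (induction "lossy_exp G \<Delta>" "verts G" r us A I arbitrary: A' I' rule: push_fail.induct)
  case (2 r A I)
  then show ?case using enum_list[of "verts G"] G by (simp add: simple_graph_def)
next
  case (3 r u us A I)
  have nb: "neighbors G u \<noteq> {}" "finite (neighbors G u)" "neighbors G u \<subseteq> verts G"
    using d 3 finite_neighbors[OF G] by auto
  show ?case
  proof (cases "u \<in> A")
    case True
    have "lossy_exp G \<Delta> u (\<lambda>x. push_fail (lossy_exp G \<Delta>) (verts G) r us A' (I' \<union> set_option x))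
      \<le> lossy_exp G \<Delta> u (\<lambda>x. push_fail (lossy_exp G \<Delta>) (verts G) r us A (I \<union> set_option x))"
      by (intro lossy_exp_mono D 3(1)[OF True]) (use 3 nb in auto)
    with True show ?thesis using 3 by auto
  next
    case False
    have le: "push_fail (lossy_exp G \<Delta>) (verts G) r us A' (I' \<union> set_option x) \<le> push_fail (lossy_exp G \<Delta>) (verts G) r us A I"
      if "set_option x \<subseteq> verts G" for x
      by (rule 3(2)[OF False]) (use 3 that in auto)
    have "lossy_exp G \<Delta> u (\<lambda>x. push_fail (lossy_exp G \<Delta>) (verts G) r us A' (I' \<union> set_option x))
      \<le> lossy_exp G \<Delta> u (\<lambda>_. push_fail (lossy_exp G \<Delta>) (verts G) r us A I)"
      by (intro lossy_exp_mono D le) (use nb in auto)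
    with False le[of None] show ?thesis by (simp add: lossy_exp_const[OF nb(1,2)])
  qed
qed auto

section \<open>Edge subsets of a graph\<close>

definition edge_subgraph :: "'a ugraph \<Rightarrow> 'a set set \<Rightarrow> 'a ugraph" where
  "edge_subgraph G F = G\<lparr>edges := F\<rparr>"

lemma edge_subgraph_simps [simp]:
  "verts (edge_subgraph G F) = verts G" "edges (edge_subgraph G F) = F"
  by (simp_all add: edge_subgraph_def)

lemma simple_edge_subgraph: "simple_graph G \<Longrightarrow> F \<subseteq> edges G \<Longrightarrow> simple_graph (edge_subgraph G F)"
  by (auto simp: simple_graph_def)

lemma neighbors_edge_subgraph_mono:
  "F \<subseteq> edges G \<Longrightarrow> neighbors (edge_subgraph G F) u \<subseteq> neighbors G u"
  by (auto simp: neighbors_def)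

definition deg_in :: "'a ugraph \<Rightarrow> 'a set set \<Rightarrow> 'a \<Rightarrow> nat" where
  "deg_in G F u = card (neighbors (edge_subgraph G F) u)"

lemma finite_edges: "simple_graph G \<Longrightarrow> finite (edges G)"
  by (rule finite_subset[of _ "Pow (verts G)"]) (auto simp: simple_graph_def)

lemma deg_in_insert:
  assumes "simple_graph G" "F \<subseteq> edges G" "{u, w} \<in> edges G - F"
  shows "deg_in G (insert {u, w} F) u = Suc (deg_in G F u)"
proof -
  have fin: "finite (neighbors (edge_subgraph G F) u)"
    by (rule finite_neighbors(1)[OF simple_edge_subgraph[OF assms(1,2)]])
  have "neighbors (edge_subgraph G (insert {u, w} F)) u = insert w (neighbors (edge_subgraph G F) u)"
    by (auto simp: neighbors_def doubleton_eq_iff)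
  then show ?thesis using fin assms by (simp add: deg_in_def neighbors_def)
qed

lemma neighbors_insert_other:
  assumes "u \<noteq> x" "u \<noteq> y"
  shows "neighbors (edge_subgraph G (insert {x, y} F)) u = neighbors (edge_subgraph G F) u"
  using assms by (auto simp: neighbors_def doubleton_eq_iff)

text \<open>The probability that percolation on the edge set \<open>E\<close> leaves exactly
  \<open>F\<close>. The ground set is a parameter so that a single edge can be split off.\<close>

definition perc_weight :: "real \<Rightarrow> 'e set \<Rightarrow> 'e set \<Rightarrow> real" where
  "perc_weight p E F = p ^ card F * (1 - p) ^ card (E - F)"

lemma perc_weight_nonneg: "0 \<le> p \<Longrightarrow> p \<le> 1 \<Longrightarrow> 0 \<le> perc_weight p E F"
  by (simp add: perc_weight_def)

lemma perc_weight_split: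
  assumes "finite E" "e \<in> E" "F \<subseteq> E - {e}"
  shows "perc_weight p E F = (1 - p) * perc_weight p (E - {e}) F"
    and "perc_weight p E (insert e F) = p * perc_weight p (E - {e}) F"
proof -
  have 1: "E - F = insert e (E - {e} - F)" "e \<notin> E - {e} - F" using assms by auto
  show "perc_weight p E F = (1 - p) * perc_weight p (E - {e}) F"
    using 1(2) assms(1) by (simp add: perc_weight_def arg_cong[OF 1(1), of card])
  have 2: "E - insert e F = E - {e} - F" by auto
  have "finite F" "e \<notin> F" using assms finite_subset by auto
  then show "perc_weight p E (insert e F) = p * perc_weight p (E - {e}) F"
    by (simp add: perc_weight_def 2)
qed

lemma sum_Pow_split:
  fixes g :: "'e set \<Rightarrow> real"
  assumes "finite E" "e \<in> E"
  shows "(\<Sum>F\<in>Pow E. g F) = (\<Sum>F\<in>Pow (E - {e}). g F + g (insert e F))"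
proof -
  have "Pow E = Pow (E - {e}) \<union> insert e ` Pow (E - {e})"
    using Pow_insert[of e "E - {e}"] assms by (simp add: insert_absorb)
  moreover have "Pow (E - {e}) \<inter> insert e ` Pow (E - {e}) = {}" by auto
  moreover have "inj_on (insert e) (Pow (E - {e}))"
    by (rule inj_on_inverseI[of _ "\<lambda>F. F - {e}"]) auto
  ultimately show ?thesis
    using assms by (simp add: sum.union_disjoint sum.reindex sum.distrib)
qed

text \<open>Pair each \<open>F\<close> lacking the edge \<open>{u, w}\<close> with
  \<open>insert {u, w} F\<close>. By \<open>bump\<close>, dropping the edge raises
  \<open>\<phi>\<close> at most by the factor \<open>1 / c\<close>, so the good part of the pair has
  mass at most \<open>\<rho> * a / c\<close>. The edge itself is present with prior \<open>p\<close>
  and is then picked with probability at least \<open>1 / (hi + 1)\<close>.\<close>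

lemma weighted_pick_lower_bound:
  fixes \<phi> :: "'a set set \<Rightarrow> real" and p c lo hi :: real
  assumes G: "simple_graph G" and e: "{u, w} \<in> edges G"
    and p: "0 \<le> p" "p \<le> 1" and c: "0 < c" "c \<le> 1" and hi: "0 \<le> hi"
    and nonneg: "\<And>F. F \<subseteq> edges G \<Longrightarrow> 0 \<le> \<phi> F"
    and bump: "\<And>F. F \<subseteq> edges G \<Longrightarrow> {u, w} \<notin> F \<Longrightarrow> lo \<le> deg_in G F u \<Longrightarrow> c * \<phi> F \<le> \<phi> (insert {u, w} F)"
    and good: "\<And>F. F \<subseteq> edges G \<Longrightarrow> good F \<Longrightarrow> lo \<le> deg_in G F u \<and> deg_in G F u \<le> hi"
  shows "p * c / (hi + 1) * (\<Sum>F\<in>Pow (edges G). of_bool (good F) * (perc_weight p (edges G) F * \<phi> F))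
    \<le> (\<Sum>F\<in>Pow (edges G). perc_weight p (edges G) F * (\<phi> F * (of_bool ({u, w} \<in> F) / deg_in G F u)))"
proof -
  define E where "E = edges G"
  define e where "e = {u, w}"
  have E: "finite E" "e \<in> E" using finite_edges[OF G] assms(2) by (auto simp: E_def e_def)
  have "p * c / (hi + 1) * (of_bool (good F) * (perc_weight p E F * \<phi> F)
        + of_bool (good (insert e F)) * (perc_weight p E (insert e F) * \<phi> (insert e F)))
    \<le> perc_weight p E F * (\<phi> F * (of_bool (e \<in> F) / deg_in G F u))
      + perc_weight p E (insert e F) * (\<phi> (insert e F) * (of_bool (e \<in> insert e F) / deg_in G (insert e F) u))"
    if F: "F \<in> Pow (E - {e})" for F
  proof -
    define \<rho> where "\<rho> = perc_weight p (E - {e}) F"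
    define a where "a = \<phi> (insert e F)"
    define m where "m = real (deg_in G F u)"
    have w: "perc_weight p E F = (1 - p) * \<rho>" "perc_weight p E (insert e F) = p * \<rho>"
      unfolding \<rho>_def using perc_weight_split[OF E] F by auto
    have \<rho>: "0 \<le> \<rho>" unfolding \<rho>_def using p by (rule perc_weight_nonneg)
    have FE: "F \<subseteq> edges G" "insert e F \<subseteq> edges G" "e \<notin> F" "{u, w} \<notin> F" using F E by (auto simp: E_def e_def)
    have a: "0 \<le> a" unfolding a_def using nonneg FE by simp
    have m': "deg_in G (insert e F) u = m + 1"
      using deg_in_insert[OF G FE(1), of u w] FE E by (simp add: m_def e_def E_def)
    have m0: "0 \<le> m" by (simp add: m_def)
    have main: "p * c / (hi + 1) * (of_bool (good F) * ((1 - p) * \<rho> * \<phi> F) + of_bool (good (insert e F)) * (p * \<rho> * a))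
      \<le> p * \<rho> * (a / (m + 1))"
    proof (cases "good F \<or> good (insert e F)")
      case False
      then show ?thesis using p \<rho> a m0 by simp
    next
      case True
      \<comment> \<open>\<open>m\<close> is the degree without the edge. Goodness of either member
        of the pair gives \<open>m \<le> hi\<close>, so the degree with the edge is at most
        \<open>hi + 1\<close>.\<close>
      have mhi: "m \<le> hi"
      proof (cases "good F")
        case True then show ?thesis using good[OF FE(1)] by (simp add: m_def)
      next
        case False
        then have "m + 1 \<le> hi" using True good[OF FE(2)] m' by simp
        then show ?thesis by simp
      qed
      have F1: "of_bool (good F) * ((1 - p) * \<rho> * \<phi> F) \<le> (1 - p) * \<rho> * (a / c)"
      proof (cases "good F")
        case True
        then have "c * \<phi> F \<le> a" unfolding a_def e_def using good[OF FE(1)] FE by (intro bump) auto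
        then have "\<phi> F \<le> a / c" using c by (simp add: field_simps)
        then have "(1 - p) * \<rho> * \<phi> F \<le> (1 - p) * \<rho> * (a / c)"
          using p \<rho> by (intro mult_left_mono) auto
        then show ?thesis using True by simp
      next
        case False
        then show ?thesis using p \<rho> a c by simp
      qed
      have "a \<le> a / c" using a c by (simp add: field_simps mult_left_le)
      then have F2: "of_bool (good (insert e F)) * (p * \<rho> * a) \<le> p * \<rho> * (a / c)"
        using p \<rho> a c mult_left_mono[of a "a / c" "p * \<rho>"] by simp
      have "p * c / (hi + 1) * (of_bool (good F) * ((1 - p) * \<rho> * \<phi> F) + of_bool (good (insert e F)) * (p * \<rho> * a))
        \<le> p * c / (hi + 1) * ((1 - p) * \<rho> * (a / c) + p * \<rho> * (a / c))"
        by (rule mult_left_mono[OF add_mono[OF F1 F2]]) (use p c hi in simp)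
      \<comment> \<open>The priors of absence and presence of the edge add up to \<open>1\<close>,
        and \<open>c\<close> cancels.\<close>
      also have "\<dots> = p * \<rho> * (a / (hi + 1))"
      proof -
        have "(1 - p) * \<rho> * x + p * \<rho> * x = \<rho> * x" for x by (simp add: algebra_simps)
        then show ?thesis using c by (simp only:) simp
      qed
      also have "\<dots> \<le> p * \<rho> * (a / (m + 1))"
      proof (rule mult_left_mono)
        show "a / (hi + 1) \<le> a / (m + 1)"
          using a m0 mhi by (intro divide_left_mono) auto
      qed (use p \<rho> in simp)
      finally show ?thesis .
    qed
    have e0: "of_bool (e \<in> F) = (0::real)" "of_bool (e \<in> insert e F) = (1::real)" using FE(3) by auto
    have "p * \<rho> * (a / (m + 1)) = (1 - p) * \<rho> * (\<phi> F * (0 / deg_in G F u)) + p * \<rho> * (a * (1 / (m + 1)))"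
      by simp
    with main show ?thesis unfolding w m' e0 a_def[symmetric] by (simp only:)
  qed
  then have "(\<Sum>F\<in>Pow (E - {e}). p * c / (hi + 1) * (of_bool (good F) * (perc_weight p E F * \<phi> F)
        + of_bool (good (insert e F)) * (perc_weight p E (insert e F) * \<phi> (insert e F))))
    \<le> (\<Sum>F\<in>Pow (E - {e}). perc_weight p E F * (\<phi> F * (of_bool (e \<in> F) / deg_in G F u))
      + perc_weight p E (insert e F) * (\<phi> (insert e F) * (of_bool (e \<in> insert e F) / deg_in G (insert e F) u)))"
    by (rule sum_mono)
  then have "p * c / (hi + 1) * (\<Sum>F\<in>Pow E. of_bool (good F) * (perc_weight p E F * \<phi> F))
    \<le> (\<Sum>F\<in>Pow E. perc_weight p E F * (\<phi> F * (of_bool (e \<in> F) / deg_in G F u)))"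
    unfolding sum_Pow_split[OF E] sum_distrib_left[symmetric] .
  then show ?thesis unfolding E_def e_def .
qed

text \<open>The point masses of \<open>choice_pmf (edge_subgraph G F) u\<close> as an explicit
  function of the hidden set \<open>F\<close>, so that they can serve as likelihood factors. For an
  isolated \<open>u\<close>, division by zero gives every \<open>Some w\<close> the value
  \<open>0\<close>.\<close>

definition pick_prob :: "'a ugraph \<Rightarrow> 'a set set \<Rightarrow> 'a \<Rightarrow> 'a option \<Rightarrow> real" where
  "pick_prob G F u x = (case x of None \<Rightarrow> of_bool (deg_in G F u = 0) | Some w \<Rightarrow> of_bool ({u, w} \<in> F) / deg_in G F u)"

text \<open>The range of outcomes is taken from \<open>G\<close> and does not vary with
  \<open>F\<close>, which allows sums over outcomes and sums over \<open>F\<close> to be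
  interchanged.\<close>

lemma choice_exp_edge_subgraph:
  assumes G: "simple_graph G" and F: "F \<subseteq> edges G"
  shows "choice_exp (edge_subgraph G F) u f = (\<Sum>x\<in>insert None (Some ` neighbors G u). pick_prob G F u x * f x)"
    and "(\<Sum>x\<in>insert None (Some ` neighbors G u). pick_prob G F u x) = 1"
proof -
  define q where "q = pick_prob G F u"
  define B where "B = neighbors (edge_subgraph G F) u"
  have H: "simple_graph (edge_subgraph G F)" by (rule simple_edge_subgraph[OF assms])
  have B: "finite B" "B \<subseteq> neighbors G u" "finite (neighbors G u)"
    unfolding B_def using finite_neighbors(1)[OF H] finite_neighbors(1)[OF G] neighbors_edge_subgraph_mono[OF F] by auto
  have c: "deg_in G F u = card B" by (simp add: deg_in_def B_def)
  have q: "q (Some w) = of_bool (w \<in> B) / card B" for w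
    by (simp add: q_def pick_prob_def c) (simp add: B_def neighbors_def)
  have eq: "choice_exp (edge_subgraph G F) u f = (\<Sum>x\<in>insert None (Some ` neighbors G u). q x * f x)" for f
  proof -
    have "(\<Sum>x\<in>insert None (Some ` neighbors G u). q x * f x)
      = of_bool (card B = 0) * f None + (\<Sum>w\<in>neighbors G u. of_bool (w \<in> B) / card B * f (Some w))"
    proof (subst sum.insert)
      have "q None = of_bool (card B = 0)" by (simp add: q_def pick_prob_def c)
      then show "q None * f None + (\<Sum>x\<in>Some ` neighbors G u. q x * f x)
        = of_bool (card B = 0) * f None + (\<Sum>w\<in>neighbors G u. of_bool (w \<in> B) / card B * f (Some w))"
        by (simp add: sum.reindex q)
    qed (use B in auto)
    also have "(\<Sum>w\<in>neighbors G u. of_bool (w \<in> B) / card B * f (Some w)) = (\<Sum>w\<in>B. f (Some w) / card B)"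
      using B by (intro sum.mono_neutral_cong_right) auto
    finally show ?thesis
      using B(1) by (simp add: choice_exp_eq[OF H] B_def[symmetric] sum_divide_distrib card_eq_0_iff)
  qed
  from eq show "choice_exp (edge_subgraph G F) u f = (\<Sum>x\<in>insert None (Some ` neighbors G u). pick_prob G F u x * f x)"
    unfolding q_def .
  from eq[of "\<lambda>_. 1"] show "(\<Sum>x\<in>insert None (Some ` neighbors G u). pick_prob G F u x) = 1"
    by (simp add: choice_exp_def q_def)
qed

section \<open>Comparison of percolated and lossy push\<close>

text \<open>
  \<open>\<phi> F\<close> stands for the likelihood of the observed pushes when \<open>F\<close> is the set of
  kept edges, and \<open>k u\<close> bounds the number of pushes made by \<open>u\<close>.
\<close>

definition weight_bump :: "'a ugraph \<Rightarrow> real \<Rightarrow> real \<Rightarrow> ('a set set \<Rightarrow> real) \<Rightarrow> ('a \<Rightarrow> nat) \<Rightarrow> 'a set \<Rightarrow> bool" where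
  "weight_bump G lo \<theta> \<phi> k I \<longleftrightarrow> (\<forall>F\<subseteq>edges G. 0 \<le> \<phi> F) \<and>
     (\<forall>F u w. F \<subseteq> edges G \<longrightarrow> {u, w} \<in> edges G - F \<longrightarrow> w \<notin> I \<longrightarrow> lo \<le> deg_in G F u \<longrightarrow>
        \<theta> ^ k u * \<phi> F \<le> \<phi> (insert {u, w} F))"

lemma pick_prob_nonneg: "0 \<le> pick_prob G F u x"
  by (simp add: pick_prob_def split: option.split)

text \<open>The new factor is the likelihood of the push just observed. Adding \<open>{y, z}\<close>
  with \<open>z\<close> uninformed alters it only if \<open>y = u\<close>. Then the degree grows
  from \<open>m\<close> to \<open>m + 1\<close>, and the ratio
  \<open>m / (m + 1) \<ge> lo / (lo + 1)\<close> is paid for by the extra power of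
  \<open>\<theta>\<close>.\<close>

lemma weight_bump_pick:
  assumes G: "simple_graph G" and lo: "0 < lo" and th: "0 \<le> \<theta>" "\<theta> \<le> lo / (lo + 1)"
    and \<phi>: "weight_bump G lo \<theta> \<phi> k I" and u: "u \<in> I"
  shows "weight_bump G lo \<theta> (\<lambda>F. \<phi> F * pick_prob G F u x) (k(u := Suc (k u))) (I \<union> set_option x)"
  unfolding weight_bump_def
proof (intro conjI allI impI)
  fix F assume "F \<subseteq> edges G"
  then show "0 \<le> \<phi> F * pick_prob G F u x"
    using \<phi> by (simp add: weight_bump_def pick_prob_nonneg)
next
  fix F y z
  assume F: "F \<subseteq> edges G" "{y, z} \<in> edges G - F" and z: "z \<notin> I \<union> set_option x" and deg: "lo \<le> deg_in G F y"
  have nonneg: "0 \<le> \<phi> F" "0 \<le> \<phi> (insert {y, z} F)"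
    using \<phi> F by (auto simp: weight_bump_def)
  have bump: "\<theta> ^ k y * \<phi> F \<le> \<phi> (insert {y, z} F)"
    using \<phi> F z deg by (auto simp: weight_bump_def)
  \<comment> \<open>The sender is informed and \<open>z\<close> is not, so the added edge can touch
    \<open>u\<close> only through \<open>y\<close>.\<close>
  have uz: "u \<noteq> z" using u z by auto
  show "\<theta> ^ (k(u := Suc (k u))) y * (\<phi> F * pick_prob G F u x) \<le> \<phi> (insert {y, z} F) * pick_prob G (insert {y, z} F) u x"
  proof (cases "y = u")
    case False
    have eq: "pick_prob G (insert {y, z} F) u x = pick_prob G F u x"
    proof -
      have "deg_in G (insert {y, z} F) u = deg_in G F u"
        using False uz by (simp add: deg_in_def neighbors_insert_other)
      moreover have "{u, w} \<in> insert {y, z} F \<longleftrightarrow> {u, w} \<in> F" for w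
        using False uz by (auto simp: doubleton_eq_iff)
      ultimately show ?thesis by (simp add: pick_prob_def split: option.split)
    qed
    show ?thesis
      unfolding eq using mult_right_mono[OF bump pick_prob_nonneg[of G F u x]] False by (simp add: mult.assoc)
  next
    case True
    note y = this
    show ?thesis
    proof (cases x)
      case None
      \<comment> \<open>A degree of at least \<open>lo > 0\<close> excludes the outcome
        \<open>None\<close>.\<close>
      have "pick_prob G F u x = 0" using deg lo y None by (simp add: pick_prob_def)
      then show ?thesis using nonneg by (simp add: pick_prob_nonneg)
    next
      case (Some w)
      define m where "m = real (deg_in G F u)"
      have m: "lo \<le> m" using deg y by (simp add: m_def)
      have m1: "real (deg_in G (insert {y, z} F) u) = m + 1"
        using deg_in_insert[OF G F(1), of y z] F y by (simp add: m_def)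
      \<comment> \<open>The receiver \<open>w\<close> counts as informed from now on, so the added
        edge is not the one that was used, and the indicator keeps its value.\<close>
      have wz: "w \<noteq> z" using z Some by auto
      have in_iff: "{u, w} \<in> insert {y, z} F \<longleftrightarrow> {u, w} \<in> F"
        using wz y by (auto simp: doubleton_eq_iff)
      have "lo / (lo + 1) \<le> m / (m + 1)"
        using m lo by (simp add: field_simps)
      then have "\<theta> \<le> m / (m + 1)" using th by linarith
      then have "\<theta> * (1 / m) \<le> 1 / (m + 1)" using m lo by (simp add: field_simps)
      then have "(\<theta> ^ k y * \<phi> F) * (\<theta> * (1 / m)) \<le> \<phi> (insert {y, z} F) * (1 / (m + 1))"
        using bump nonneg th m lo by (intro mult_mono) auto
      then have "of_bool ({u, w} \<in> F) * ((\<theta> ^ k y * \<phi> F) * (\<theta> * (1 / m))) \<le> of_bool ({u, w} \<in> F) * (\<phi> (insert {y, z} F) * (1 / (m + 1)))"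
        by (intro mult_left_mono) auto
      moreover have "pick_prob G F u x = of_bool ({u, w} \<in> F) * (1 / m)"
        by (simp add: pick_prob_def Some m_def)
      moreover have "pick_prob G (insert {y, z} F) u x = of_bool ({u, w} \<in> F) * (1 / (m + 1))"
        by (simp only: pick_prob_def Some option.case m1 in_iff) simp
      ultimately show ?thesis
        using y by (simp only: fun_upd_same power_Suc mult_ac)
    qed
  qed
qed

text \<open>All sums are unnormalized: divided by the mass of the history they become conditional
  probabilities given the pushes seen so far. The error is the mass of irregular edge sets over
  \<open>\<delta>\<close>. It is additive over the outcomes of a push and therefore does not
  accumulate along the induction. The last assumption is a budget: the pushes already made by
  \<open>u\<close> and those still possible stay within \<open>N\<close>.\<close>

lemma percolated_push_fail_le_lossy:
  fixes p lo hi \<theta> \<delta> \<Delta> :: real and N :: nat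
  assumes G: "simple_graph G" and d: "\<And>u. u \<in> verts G \<Longrightarrow> neighbors G u \<noteq> {}"
    and p: "0 \<le> p" "p \<le> 1" and D: "0 \<le> \<Delta>" "\<Delta> \<le> 1" and \<delta>: "0 < \<delta>"
    and lo: "0 < lo" and hi: "0 \<le> hi" and th: "0 < \<theta>" "\<theta> \<le> lo / (lo + 1)"
    and step: "\<And>u. u \<in> verts G \<Longrightarrow> (1 - \<Delta>) / card (neighbors G u) \<le> p * \<theta> ^ N / (hi + 1) * (1 - \<delta>)"
  defines "bad \<equiv> \<lambda>F. \<exists>u\<in>verts G. deg_in G F u < lo \<or> deg_in G F u > hi"
  assumes "weight_bump G lo \<theta> \<phi> k I" "set us \<subseteq> verts G" "distinct us" "A \<subseteq> I" "I \<subseteq> verts G"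
    and "\<And>u. k u + r + of_bool (u \<in> set us) \<le> N"
  shows "(\<Sum>F\<in>Pow (edges G). perc_weight p (edges G) F * \<phi> F * push_fail (choice_exp (edge_subgraph G F)) (verts G) r us A I)
    \<le> push_fail (lossy_exp G \<Delta>) (verts G) r us A I * (\<Sum>F\<in>Pow (edges G). perc_weight p (edges G) F * \<phi> F)
      + (\<Sum>F\<in>Pow (edges G). of_bool (bad F) * (perc_weight p (edges G) F * \<phi> F)) / \<delta>"
  using assms(14-)
proof (induction "lossy_exp G \<Delta>" "verts G" r us A I arbitrary: \<phi> k rule: push_fail.induct)
  case (1 A I)
  define g where "g F = perc_weight p (edges G) F * \<phi> F" for F
  have g: "0 \<le> g F" if "F \<in> Pow (edges G)" for F
    using that 1(1) p by (auto simp: g_def weight_bump_def perc_weight_nonneg)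
  have B: "0 \<le> (\<Sum>F\<in>Pow (edges G). of_bool (bad F) * g F) / \<delta>"
    using g \<delta> by (intro divide_nonneg_pos sum_nonneg mult_nonneg_nonneg) auto
  show ?case
  proof (cases "I = verts G")
    case True
    then show ?thesis using B by (simp add: g_def)
  next
    case False
    then show ?thesis using B by (simp add: g_def)
  qed
next
  case (2 r A I)
  have L: "set (enum_list (verts G)) = verts G" "distinct (enum_list (verts G))"
    using enum_list[of "verts G"] G by (auto simp: simple_graph_def)
  \<comment> \<open>A new round spends one of the remaining rounds and grants each vertex one turn,
    so the budget is kept.\<close>
  have k: "k u + r + of_bool (u \<in> set (enum_list (verts G))) \<le> N" for u
    using 2(7)[of u] by (auto simp: of_bool_def)
  show ?case
    using 2(1)[OF 2(2) _ _ _ _ k] 2 L by simp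
next
  case (3 r u us A I)
  have uV: "u \<in> verts G" and us: "set us \<subseteq> verts G" "distinct us" "u \<notin> set us" using 3 by auto
  show ?case
  proof (cases "u \<in> A")
    case False
    have k: "k x + r + of_bool (x \<in> set us) \<le> N" for x
      using 3(8)[of x] by (auto simp: of_bool_def split: if_splits)
    show ?thesis
      using 3(2)[OF False 3(3) us(1,2) 3(6,7) k] False by simp
  next
    case True
    define E where "E = edges G"
    define W where "W = perc_weight p E"
    define pf where "pf F x = push_fail (choice_exp (edge_subgraph G F)) (verts G) r us A (I \<union> set_option x)" for F x
    define lf where "lf x = push_fail (lossy_exp G \<Delta>) (verts G) r us A (I \<union> set_option x)" for x
    define N1 where "N1 = neighbors G u"
    define X where "X = insert None (Some ` N1)"
    define q where "q = (\<lambda>F. pick_prob G F u)"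
    \<comment> \<open>\<open>Q\<close> is the mass of the history and \<open>Qx x\<close> its part
      in which the push of \<open>u\<close> has outcome \<open>x\<close>. \<open>B\<close> and
      \<open>Bx\<close> are the shares of irregular edge sets in them.\<close>
    define Q where "Q = (\<Sum>F\<in>Pow E. W F * \<phi> F)"
    define B where "B = (\<Sum>F\<in>Pow E. of_bool (bad F) * (W F * \<phi> F))"
    define Qx where "Qx x = (\<Sum>F\<in>Pow E. W F * (\<phi> F * q F x))" for x
    define Bx where "Bx x = (\<Sum>F\<in>Pow E. of_bool (bad F) * (W F * (\<phi> F * q F x)))" for x
    have uI: "u \<in> I" using True 3 by auto
    have N1: "finite N1" "N1 \<subseteq> verts G" "N1 \<noteq> {}"
      unfolding N1_def using finite_neighbors[OF G] d[OF uV] by auto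
    have finX: "finite X" using N1 by (simp add: X_def)
    have W: "0 \<le> W F" for F unfolding W_def using p by (rule perc_weight_nonneg)
    have \<phi>: "0 \<le> \<phi> F" if "F \<in> Pow E" for F using 3(3) that by (auto simp: weight_bump_def E_def)
    have q0: "0 \<le> q F x" for F x by (simp add: q_def pick_prob_nonneg)
    have q1: "(\<Sum>x\<in>X. q F x) = 1" if "F \<in> Pow E" for F
      unfolding q_def X_def N1_def using that by (intro choice_exp_edge_subgraph(2)[OF G]) (simp add: E_def)
    have unfold_pf: "push_fail (choice_exp (edge_subgraph G F)) (verts G) r (u # us) A I = (\<Sum>x\<in>X. q F x * pf F x)"
      if "F \<in> Pow E" for F
      using True that choice_exp_edge_subgraph(1)[OF G, of F u "pf F"] unfolding pf_def
      by (simp add: E_def q_def X_def N1_def)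
    have unfold_l: "push_fail (lossy_exp G \<Delta>) (verts G) r (u # us) A I = lossy_exp G \<Delta> u lf"
      using True by (simp add: lf_def[abs_def])
    have l_bounds: "0 \<le> lf x" for x
      unfolding lf_def using push_fail_lossy_bounds[OF G D d us(1)] by auto
    have Q0: "0 \<le> Q" unfolding Q_def using W \<phi> by (intro sum_nonneg) auto
    have B0: "0 \<le> B" unfolding B_def using W \<phi> by (intro sum_nonneg) auto
    have lossy0: "0 \<le> lossy_exp G \<Delta> u lf"
      unfolding lossy_exp_def using D l_bounds
      by (intro add_nonneg_nonneg mult_nonneg_nonneg divide_nonneg_nonneg sum_nonneg) auto
    have sumQ: "(\<Sum>x\<in>X. Qx x) = Q"
    proof -
      have "(\<Sum>x\<in>X. Qx x) = (\<Sum>F\<in>Pow E. \<Sum>x\<in>X. W F * (\<phi> F * q F x))"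
        unfolding Qx_def by (rule sum.swap)
      also have "\<dots> = Q"
        unfolding Q_def using q1 by (intro sum.cong) (simp_all flip: sum_distrib_left)
      finally show ?thesis .
    qed
    have sumB: "(\<Sum>x\<in>X. Bx x) = B"
    proof -
      have "(\<Sum>x\<in>X. Bx x) = (\<Sum>F\<in>Pow E. \<Sum>x\<in>X. of_bool (bad F) * (W F * (\<phi> F * q F x)))"
        unfolding Bx_def by (rule sum.swap)
      also have "\<dots> = B"
        unfolding B_def using q1 by (intro sum.cong) (simp_all flip: sum_distrib_left)
      finally show ?thesis .
    qed
    have Qx0: "0 \<le> Qx x" for x unfolding Qx_def using W \<phi> q0 by (intro sum_nonneg) auto
    \<comment> \<open>The outcome \<open>x\<close> is absorbed into the likelihood before the
      induction hypothesis is applied.\<close>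
    have IH: "(\<Sum>F\<in>Pow E. W F * (\<phi> F * q F x) * pf F x) \<le> lf x * Qx x + Bx x / \<delta>" if x: "x \<in> X" for x
      unfolding E_def W_def pf_def lf_def Qx_def Bx_def q_def
    proof (rule 3(1)[OF True])
      show "weight_bump G lo \<theta> (\<lambda>F. \<phi> F * pick_prob G F u x) (k(u := Suc (k u))) (I \<union> set_option x)"
        using weight_bump_pick[OF G lo _ th(2) 3(3) uI] th(1) by simp
      show "I \<union> set_option x \<subseteq> verts G" using x N1 3(7) by (auto simp: X_def)
      show "(k(u := Suc (k u))) y + r + of_bool (y \<in> set us) \<le> N" for y
        using 3(8)[of y] us(3) by (auto simp: of_bool_def split: if_splits)
    qed (use us 3 in auto)
    have lhs: "(\<Sum>F\<in>Pow E. W F * \<phi> F * push_fail (choice_exp (edge_subgraph G F)) (verts G) r (u # us) A I)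
      = (\<Sum>x\<in>X. \<Sum>F\<in>Pow E. W F * (\<phi> F * q F x) * pf F x)"
      unfolding sum.swap[of _ _ X]
      by (intro sum.cong refl) (simp add: unfold_pf sum_distrib_left mult_ac del: push_fail.simps)
    have "(\<Sum>F\<in>Pow E. W F * \<phi> F * push_fail (choice_exp (edge_subgraph G F)) (verts G) r (u # us) A I)
      \<le> lossy_exp G \<Delta> u lf * Q + B / \<delta>"
    proof (cases "B \<le> \<delta> * Q")
      case False \<comment> \<open>irregular degrees are likely, so the error term absorbs everything\<close>
      have "(\<Sum>F\<in>Pow E. W F * \<phi> F * push_fail (choice_exp (edge_subgraph G F)) (verts G) r (u # us) A I)
        \<le> (\<Sum>F\<in>Pow E. W F * \<phi> F * 1)"
      proof (intro sum_mono mult_left_mono)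
        fix F assume "F \<in> Pow E"
        then have H: "simple_graph (edge_subgraph G F)" using simple_edge_subgraph[OF G] by (simp add: E_def)
        show "push_fail (choice_exp (edge_subgraph G F)) (verts G) r (u # us) A I \<le> 1"
          using push_fail_choice_bounds[OF H, of "u # us"] us uV by (simp del: push_fail.simps)
        show "0 \<le> W F * \<phi> F" using W \<phi> \<open>F \<in> Pow E\<close> by simp
      qed
      also have "\<dots> = Q" by (simp add: Q_def)
      also have "Q \<le> B / \<delta>" using False \<delta> by (simp add: field_simps)
      finally show ?thesis using lossy0 Q0 by (smt (verit) mult_nonneg_nonneg)
    next
      case True
      define c where "c = (1 - \<Delta>) / card N1"
      \<comment> \<open>For uninformed \<open>w\<close>, the conditional probability of a push to
        \<open>w\<close> is at least the rate \<open>c\<close> of the lossy protocol.\<close>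
      have lower: "c * Q \<le> Qx (Some w)" if w: "w \<in> N1" "w \<notin> I" for w
      proof -
        have e: "{u, w} \<in> edges G" using w by (simp add: N1_def neighbors_def)
        have th1: "\<theta> \<le> 1"
        proof -
          have "lo / (lo + 1) \<le> 1" using lo by simp
          then show ?thesis using th by linarith
        qed
        have "p * \<theta> ^ k u / (hi + 1) * (\<Sum>F\<in>Pow (edges G). of_bool (\<not> bad F) * (perc_weight p (edges G) F * \<phi> F))
          \<le> (\<Sum>F\<in>Pow (edges G). perc_weight p (edges G) F * (\<phi> F * (of_bool ({u, w} \<in> F) / deg_in G F u)))"
        proof (rule weighted_pick_lower_bound[OF G e p _ _ hi])
          show "0 < \<theta> ^ k u" "\<theta> ^ k u \<le> 1" using th th1 by (auto intro: power_le_one)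
          show "0 \<le> \<phi> F" if "F \<subseteq> edges G" for F using \<phi> that by (simp add: E_def)
          show "\<theta> ^ k u * \<phi> F \<le> \<phi> (insert {u, w} F)" if "F \<subseteq> edges G" "{u, w} \<notin> F" "lo \<le> deg_in G F u" for F
            using 3(3) that e w by (auto simp: weight_bump_def)
          show "lo \<le> deg_in G F u \<and> deg_in G F u \<le> hi" if "\<not> bad F" for F
            using that uV by (auto simp: bad_def not_less)
        qed
        also have "\<dots> = Qx (Some w)"
          by (simp add: Qx_def q_def pick_prob_def W_def E_def)
        also have "(\<Sum>F\<in>Pow (edges G). of_bool (\<not> bad F) * (perc_weight p (edges G) F * \<phi> F)) = Q - B"
          unfolding Q_def B_def sum_subtractf[symmetric] E_def W_def by (intro sum.cong) auto
        finally have 1: "p * \<theta> ^ k u / (hi + 1) * (Q - B) \<le> Qx (Some w)" .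
        have ku: "k u \<le> N" using 3(8)[of u] by simp
        have "c * Q \<le> p * \<theta> ^ N / (hi + 1) * (1 - \<delta>) * Q"
          using step[OF uV] Q0 unfolding c_def N1_def by (intro mult_right_mono) auto
        also have "\<dots> = p * \<theta> ^ N / (hi + 1) * (Q - \<delta> * Q)" by (simp add: algebra_simps)
        \<comment> \<open>In the present case at least a share \<open>1 - \<delta>\<close> of the
          mass is regular.\<close>
        also have "\<dots> \<le> p * \<theta> ^ N / (hi + 1) * (Q - B)"
          using True p th hi by (intro mult_left_mono) auto
        also have "\<dots> \<le> p * \<theta> ^ k u / (hi + 1) * (Q - B)"
        proof (intro mult_right_mono divide_right_mono mult_left_mono)
          show "\<theta> ^ N \<le> \<theta> ^ k u" using ku th th1 by (intro power_decreasing) auto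
          have "B \<le> Q" unfolding B_def Q_def using W \<phi> by (intro sum_mono) auto
          then show "0 \<le> Q - B" by simp
        qed (use p hi in auto)
        also note 1
        finally show ?thesis .
      qed
      have anti: "lf (Some w) \<le> lf None" if "w \<in> N1" for w
        unfolding lf_def using us 3(7) that N1(2) by (intro push_fail_lossy_antimono[OF G D d]) auto
      \<comment> \<open>For informed \<open>w\<close> there is no lower bound on \<open>Qx\<close>,
        but a push to it changes nothing, so both sides vanish.\<close>
      have drop: "c * Q * (lf None - lf (Some w)) \<le> Qx (Some w) * (lf None - lf (Some w))" if w: "w \<in> N1" for w
      proof (cases "w \<in> I")
        case True
        then have "lf None = lf (Some w)" by (simp add: lf_def insert_absorb)
        then show ?thesis by simp
      next
        case False
        then show ?thesis using lower[OF w False] anti[OF w] by (intro mult_right_mono) auto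
      qed
      \<comment> \<open>Measured against idling, an outcome contributes only its drop
        \<open>lf None - lf x\<close>, which is nonnegative. Hence lower bounds on the masses of the
        outcomes suffice.\<close>
      have "(\<Sum>x\<in>X. lf x * Qx x) = lf None * Q - (\<Sum>x\<in>X. Qx x * (lf None - lf x))"
        unfolding sumQ[symmetric] sum_distrib_left sum_subtractf[symmetric]
        by (intro sum.cong) (auto simp: algebra_simps)
      also have "(\<Sum>x\<in>X. Qx x * (lf None - lf x)) = (\<Sum>w\<in>N1. Qx (Some w) * (lf None - lf (Some w)))"
        unfolding X_def using N1 by (subst sum.insert) (auto simp: sum.reindex)
      also have "lf None * Q - \<dots> \<le> lf None * Q - (\<Sum>w\<in>N1. c * Q * (lf None - lf (Some w)))"
        using drop by (intro diff_left_mono sum_mono)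
      also have "\<dots> = lossy_exp G \<Delta> u lf * Q"
      proof -
        have a: "c * card N1 = 1 - \<Delta>" using N1 by (simp add: c_def)
        have b: "lossy_exp G \<Delta> u lf = \<Delta> * lf None + c * (\<Sum>w\<in>N1. lf (Some w))"
          by (simp add: lossy_exp_def N1_def c_def)
        have "(\<Sum>w\<in>N1. c * Q * (lf None - lf (Some w))) = c * card N1 * (Q * lf None) - c * Q * (\<Sum>w\<in>N1. lf (Some w))"
          by (simp add: sum_subtractf sum_distrib_left[symmetric] right_diff_distrib)
        then show ?thesis unfolding a b by (simp only:) (simp add: algebra_simps)
      qed
      finally have main: "(\<Sum>x\<in>X. lf x * Qx x) \<le> lossy_exp G \<Delta> u lf * Q" .
      have "(\<Sum>F\<in>Pow E. W F * \<phi> F * push_fail (choice_exp (edge_subgraph G F)) (verts G) r (u # us) A I)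
        \<le> (\<Sum>x\<in>X. lf x * Qx x + Bx x / \<delta>)"
        unfolding lhs using IH by (intro sum_mono)
      also have "\<dots> = (\<Sum>x\<in>X. lf x * Qx x) + B / \<delta>"
        by (simp add: sum.distrib sumB flip: sum_divide_distrib)
      finally show ?thesis using main by linarith
    qed
    then show ?thesis unfolding unfold_l Q_def B_def E_def W_def .
  qed
qed

section \<open>Lossy push is only slightly slower\<close>

text \<open>
  The push protocol in which a vertex \<open>z\<close> is, in addition, informed from outside at time
  \<open>a z\<close>; clocks beyond the time horizon mark the uninformed vertices.
\<close>

fun active :: "('a \<Rightarrow> nat) \<Rightarrow> (nat \<times> 'a \<Rightarrow> 'a option) \<Rightarrow> nat \<Rightarrow> 'a set" where
  "active a c 0 = {z. a z = 0}"
| "active a c (Suc t) = active a c t \<union> {z. a z \<le> Suc t} \<union> {w. \<exists>u\<in>active a c t. c (t, u) = Some w}"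

lemma active_mono: "s \<le> t \<Longrightarrow> active a c s \<subseteq> active a c t"
  by (induction rule: dec_induct) auto

lemma active_start: "a z \<le> t \<Longrightarrow> z \<in> active a c t"
  by (cases t) auto

lemma active_push: "u \<in> active a c s \<Longrightarrow> c (s, u) = Some w \<Longrightarrow> s < t \<Longrightarrow> w \<in> active a c t"
  using active_mono[of "Suc s" t a c] by auto

lemma active_upd:
  "t \<le> s \<Longrightarrow> active a (c((s, u) := x)) t = active a c t"
  by (induction t) auto

lemma active_informed:
  "t \<le> T \<Longrightarrow> active (\<lambda>z. if z = v then 0 else Suc T) c t = informed v c t"
proof (induction t)
  case (Suc t)
  have "{z. (if z = v then 0 else Suc T) \<le> Suc t} = {v}" using Suc.prems by auto
  moreover have "v \<in> informed v c t" using informed_mono[of 0 t v c] by auto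
  ultimately show ?case using Suc by auto
qed auto

lemma active_late:
  assumes "\<And>z. T \<le> a z" "t < T"
  shows "active a c t = {}"
  using assms(2)
proof (induction t)
  case 0
  have "a z \<noteq> 0" for z using assms(1)[of z] 0 by simp
  then show ?case by simp
next
  case (Suc t)
  have "\<not> a z \<le> Suc t" for z using assms(1)[of z] Suc.prems by simp
  then show ?case using Suc by simp
qed

text \<open>A push of \<open>u\<close> at its clock time is traded for a delay: \<open>u\<close>
  enters one time step later, while \<open>w\<close> enters at that step unless its own clock is
  earlier.\<close>

definition advance :: "('a \<Rightarrow> nat) \<Rightarrow> 'a \<Rightarrow> 'a \<Rightarrow> 'a \<Rightarrow> nat" where
  "advance a u w = a(u := Suc (a u), w := min (a w) (Suc (a u)))"

text \<open>
  If \<open>u\<close> is pushed to before its clock time, then a push made in advance at time \<open>a u\<close> is an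
  additional one. Otherwise it replaces the push of \<open>u\<close> at time \<open>a u\<close>, whose choice is
  not used elsewhere.
\<close>

definition early :: "('a \<Rightarrow> nat) \<Rightarrow> (nat \<times> 'a \<Rightarrow> 'a option) \<Rightarrow> 'a \<Rightarrow> bool" where
  "early a c u \<longleftrightarrow> (\<exists>t<a u. \<exists>x\<in>active a c t. c (t, x) = Some u)"

text \<open>\<open>early\<close> reads only choices at times before \<open>a u\<close>, so it is
  decided before the choice at \<open>(a u, u)\<close> is drawn.\<close>

lemma early_upd: "early a (c((a u, u) := y)) u \<longleftrightarrow> early a c u"
  by (simp add: early_def active_upd cong: conj_cong)

text \<open>Only the clock of \<open>u\<close> has grown. By strong induction the early push to
  \<open>u\<close> also happens with the advanced clocks, so \<open>u\<close> is still active no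
  later than time \<open>a u\<close>.\<close>

lemma active_advance_early:
  assumes "early a c u" "w \<noteq> u"
  shows "active a c t \<subseteq> active (advance a u w) c t"
proof (induction t rule: less_induct)
  case (less t)
  have start: "z \<in> active (advance a u w) c t" if "a z \<le> t" for z
  proof (cases "z = u")
    case False
    then have "advance a u w z \<le> t" using that by (auto simp: advance_def)
    then show ?thesis by (rule active_start)
  next
    case True
    from assms(1) obtain s x where s: "s < a u" "x \<in> active a c s" "c (s, x) = Some u"
      by (auto simp: early_def)
    then have "x \<in> active (advance a u w) c s" using less[of s] that True by auto
    then show ?thesis using s that True by (auto intro: active_push)
  qed
  show ?case
  proof (cases t)
    case 0
    then show ?thesis using start by auto
  next
    case (Suc s)
    have "active a c s \<subseteq> active (advance a u w) c s" using less Suc by auto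
    then show ?thesis using start Suc by auto
  qed
qed

text \<open>On the left \<open>u\<close> pushes to \<open>w\<close> at time \<open>a u\<close>. On
  the right the clock of \<open>w\<close> accounts for this push, whatever \<open>c (a u, u)\<close>
  is. The delay of \<open>u\<close> by one step causes the exception up to time
  \<open>a u\<close>.\<close>

lemma active_advance_late:
  assumes "\<not> early a c u" "w \<noteq> u"
  shows "active a (c((a u, u) := Some w)) t \<subseteq> active (advance a u w) c t \<union> (if t \<le> a u then {u} else {})"
proof (induction t)
  case 0
  then show ?case using assms(2) by (auto simp: advance_def)
next
  case (Suc t)
  let ?c = "c((a u, u) := Some w)" and ?a = "advance a u w"
  \<comment> \<open>With no early push, \<open>u\<close> enters only through its clock, so before
    time \<open>a u\<close> it makes no push that the delay could destroy.\<close>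
  have nu: "u \<notin> active a ?c s" if "s < a u" for s
    using that
  proof (induction s)
    case (Suc s)
    have "\<not> early a ?c u" using assms(1) by (simp add: early_upd)
    then show ?case using Suc by (auto simp: early_def simp del: fun_upd_apply)
  qed auto
  show ?case
  proof
    fix z assume "z \<in> active a ?c (Suc t)"
    then consider "z \<in> active a ?c t" | "a z \<le> Suc t" | x where "x \<in> active a ?c t" "?c (t, x) = Some z"
      by auto
    then show "z \<in> active ?a c (Suc t) \<union> (if Suc t \<le> a u then {u} else {})"
    proof cases
      case 1
      then have "z \<in> active ?a c t \<or> z = u" using Suc.IH by (auto simp del: fun_upd_apply split: if_splits)
      moreover have "u \<in> active ?a c (Suc t)" if "\<not> Suc t \<le> a u"
        using that assms(2) by (intro active_start) (auto simp: advance_def)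
      ultimately show ?thesis by auto
    next
      case 2
      have "z \<in> active ?a c (Suc t)" if "z \<noteq> u"
        using that 2 by (intro active_start) (auto simp: advance_def)
      moreover have "u \<in> active ?a c (Suc t)" if "\<not> Suc t \<le> a u"
        using that assms(2) by (intro active_start) (auto simp: advance_def)
      ultimately show ?thesis by auto
    next
      case 3
      show ?thesis
      proof (cases "(t, x) = (a u, u)")
        case True
        \<comment> \<open>This is the replaced push, so \<open>z = w\<close>, whose advanced clock
          is at most \<open>Suc (a u)\<close>.\<close>
        then have "?a z \<le> Suc t" using 3 by (auto simp: advance_def)
        then show ?thesis using active_start[of ?a z "Suc t" c] by blast
      next
        case False
        have "x \<in> active ?a c t"
        proof (cases "x = u")
          case True
          with False have "t \<noteq> a u" by auto
          moreover have "\<not> t < a u" using nu[of t] 3 True by auto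
          ultimately show ?thesis using Suc.IH 3 by (auto simp del: fun_upd_apply)
        next
          case False
          then show ?thesis using Suc.IH 3 by (auto simp del: fun_upd_apply split: if_splits)
        qed
        moreover have "c (t, x) = Some z" using 3 False by auto
        ultimately show ?thesis by auto
      qed
    qed
  qed
qed

section \<open>Failure of the lossless protocol as a function of the clocks\<close>

definition late_prob :: "'a ugraph \<Rightarrow> nat \<Rightarrow> ('a \<Rightarrow> nat) \<Rightarrow> real" where
  "late_prob G T a = measure_pmf.expectation (push_choices G T) (\<lambda>c. of_bool (\<not> verts G \<subseteq> active a c T))"

lemma late_prob_nonneg: "0 \<le> late_prob G T a"
  unfolding late_prob_def by (intro integral_nonneg_AE) auto

text \<open>Condition on all choices except that of \<open>u\<close> at time \<open>a u\<close>,
  which is uniform over the neighbors. If \<open>u\<close> is reached early, the push to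
  \<open>w\<close> comes on top of all others. Otherwise \<open>w\<close> takes the place of the
  omitted choice, and averaging over \<open>w\<close> reproduces the average over that
  choice.\<close>

lemma late_prob_advance:
  assumes G: "simple_graph G" and u: "u \<in> verts G" "neighbors G u \<noteq> {}" and au: "a u < T"
  shows "(\<Sum>w\<in>neighbors G u. late_prob G T (advance a u w)) / card (neighbors G u) \<le> late_prob G T a"
proof -
  define N where "N = neighbors G u"
  define J where "J = {..<T} \<times> verts G - {(a u, u)}"
  define K where "K = Pi_pmf J None (\<lambda>j. choice_pmf G (snd j))"
  define bad where "bad b c = (of_bool (\<not> verts G \<subseteq> active b c T) :: real)" for b c
  have N: "finite N" "N \<noteq> {}" "0 < real (card N)" "u \<notin> N"
    using u G finite_neighbors(1)[OF G, of u] by (auto simp: N_def card_gt_0_iff simple_graph_def neighbors_def)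
  have J: "finite J" "(a u, u) \<notin> J" "{..<T} \<times> verts G = insert (a u, u) J"
    using G u au by (auto simp: J_def simple_graph_def)
  have finK: "finite (set_pmf K)"
    unfolding K_def using J G by (simp add: set_Pi_pmf finite_PiE_dflt finite_set_choice_pmf)
  have int: "integrable (measure_pmf K) f" for f :: "_ \<Rightarrow> real"
    by (rule integrable_measure_pmf_finite[OF finK])
  have lp: "late_prob G T b = measure_pmf.expectation K (\<lambda>g. (\<Sum>y\<in>N. bad b (g((a u, u) := Some y))) / card N)" for b
  proof -
    have fin: "finite (set_pmf (choice_pmf G (snd j)))" for j :: "nat \<times> 'a"
      by (rule finite_set_choice_pmf[OF G])
    have "late_prob G T b = choice_exp G u (\<lambda>y. measure_pmf.expectation K (\<lambda>g. bad b (g((a u, u) := y))))"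
      unfolding late_prob_def push_choices_def J(3) K_def choice_exp_def bad_def
        expectation_Pi_pmf_insert[where p="\<lambda>j. choice_pmf G (snd j)", OF J(1,2) fin fin] snd_conv ..
    also have "\<dots> = (\<Sum>y\<in>N. measure_pmf.expectation K (\<lambda>g. bad b (g((a u, u) := Some y)))) / card N"
      using N by (simp add: choice_exp_eq[OF G] N_def)
    also have "\<dots> = measure_pmf.expectation K (\<lambda>g. (\<Sum>y\<in>N. bad b (g((a u, u) := Some y))) / card N)"
      using int by (simp add: Bochner_Integration.integral_sum)
    finally show ?thesis .
  qed
  have "(\<Sum>w\<in>N. late_prob G T (advance a u w)) / card N
    = measure_pmf.expectation K (\<lambda>g. (\<Sum>w\<in>N. (\<Sum>y\<in>N. bad (advance a u w) (g((a u, u) := Some y))) / card N) / card N)"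
    unfolding lp using int by (simp add: Bochner_Integration.integral_sum)
  also have "\<dots> \<le> measure_pmf.expectation K (\<lambda>g. (\<Sum>y\<in>N. bad a (g((a u, u) := Some y))) / card N)"
  proof (rule integral_mono[OF int int])
    fix g
    show "(\<Sum>w\<in>N. (\<Sum>y\<in>N. bad (advance a u w) (g((a u, u) := Some y))) / card N) / card N
      \<le> (\<Sum>y\<in>N. bad a (g((a u, u) := Some y))) / card N"
    proof (cases "early a g u")
      case True
      have le: "bad (advance a u w) (g((a u, u) := Some y)) \<le> bad a (g((a u, u) := Some y))" if "w \<in> N" for w y
      proof -
        have "active a (g((a u, u) := Some y)) T \<subseteq> active (advance a u w) (g((a u, u) := Some y)) T"
          using True N that by (intro active_advance_early) (auto simp: early_upd simp del: fun_upd_apply)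
        then show ?thesis by (auto simp: bad_def)
      qed
      have "(\<Sum>w\<in>N. (\<Sum>y\<in>N. bad (advance a u w) (g((a u, u) := Some y))) / card N)
        \<le> (\<Sum>w\<in>N. (\<Sum>y\<in>N. bad a (g((a u, u) := Some y))) / card N)"
        using N le by (intro sum_mono divide_right_mono) auto
      also have "\<dots> = (\<Sum>y\<in>N. bad a (g((a u, u) := Some y)))" using N by simp
      finally show ?thesis using N by (intro divide_right_mono) auto
    next
      case False
      \<comment> \<open>For every drawn choice \<open>y\<close>, the advanced clocks do at least as
        well as the original clocks with choice \<open>w\<close>. Since \<open>a u < T\<close>, the
        exceptional vertex \<open>u\<close> has disappeared by time \<open>T\<close>.\<close>
      have le: "bad (advance a u w) (g((a u, u) := Some y)) \<le> bad a (g((a u, u) := Some w))" if "w \<in> N" for w y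
      proof -
        have "active a ((g((a u, u) := Some y))((a u, u) := Some w)) T
          \<subseteq> active (advance a u w) (g((a u, u) := Some y)) T \<union> (if T \<le> a u then {u} else {})"
          using False N that by (intro active_advance_late) (auto simp: early_upd simp del: fun_upd_apply)
        then show ?thesis using au by (auto simp: bad_def)
      qed
      have "(\<Sum>w\<in>N. (\<Sum>y\<in>N. bad (advance a u w) (g((a u, u) := Some y))) / card N)
        \<le> (\<Sum>w\<in>N. (\<Sum>y\<in>N. bad a (g((a u, u) := Some w))) / card N)"
        using N le by (intro sum_mono divide_right_mono) auto
      also have "\<dots> = (\<Sum>w\<in>N. bad a (g((a u, u) := Some w)))" using N by simp
      finally show ?thesis using N by (intro divide_right_mono) auto
    qed
  qed
  finally show ?thesis unfolding lp[of a] N_def .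
qed

text \<open>A potential of the clocks below \<open>T\<close>. A vertex in \<open>U\<close> still has
  its turn in the current round, so its term is discounted in advance by the factor
  \<open>\<rho>\<close> that a turn gains on average.\<close>

definition clock_weight :: "'a set \<Rightarrow> nat \<Rightarrow> real \<Rightarrow> real \<Rightarrow> 'a set \<Rightarrow> ('a \<Rightarrow> nat) \<Rightarrow> real" where
  "clock_weight V T y \<rho> U a = (\<Sum>u\<in>V. (if u \<in> U then \<rho> else 1) * (if a u < T then y ^ a u else 0))"

text \<open>The case of a lost push: \<open>u\<close> forfeits its discount without
  advancing.\<close>

lemma clock_weight_process:
  assumes "finite V" "u \<in> V" "u \<in> U" "a u < T"
  shows "clock_weight V T y \<rho> (U - {u}) a = clock_weight V T y \<rho> U a + (1 - \<rho>) * y ^ a u"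
  using assms unfolding clock_weight_def
  by (subst (1 2) sum.remove[of V u]) (auto simp: algebra_simps intro!: sum.cong)

text \<open>The term of \<open>u\<close> drops from \<open>\<rho> * y ^ a u\<close> to at most
  \<open>y * y ^ a u\<close>, and the term of \<open>w\<close> grows by at most
  \<open>y * y ^ a u\<close>.\<close>

lemma clock_weight_advance:
  assumes V: "finite V" "u \<in> V" "w \<in> V" "u \<noteq> w" and "u \<in> U" "a u < T" and y: "0 \<le> y" "y \<le> 1" and r: "0 \<le> \<rho>" "\<rho> \<le> 1"
  shows "clock_weight V T y \<rho> (U - {u}) (advance a u w) \<le> clock_weight V T y \<rho> U a + (2 * y - \<rho>) * y ^ a u"
proof -
  define g where "g U b x = (if x \<in> U then \<rho> else 1) * (if b x < T then y ^ b x else 0)" for U and b :: "'a \<Rightarrow> nat" and x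
  have "clock_weight V T y \<rho> W b = g W b u + g W b w + sum (g W b) (V - {u} - {w})" for W b
    unfolding clock_weight_def g_def[symmetric] using V
    by (subst sum.remove[of V u], simp, simp, subst sum.remove[of "V - {u}" w]) auto
  moreover have "sum (g (U - {u}) (advance a u w)) (V - {u} - {w}) = sum (g U a) (V - {u} - {w})"
    by (intro sum.cong) (auto simp: g_def advance_def)
  moreover have "g (U - {u}) (advance a u w) u \<le> y * y ^ a u"
    using V y by (auto simp: g_def advance_def)
  moreover have "g U a u = \<rho> * y ^ a u" using assms by (simp add: g_def)
  moreover have "g (U - {u}) (advance a u w) w \<le> g U a w + y * y ^ a u"
  proof -
    define k where "k = (if w \<in> U then \<rho> else 1)"
    have k: "0 \<le> k" "k \<le> 1" using r by (auto simp: k_def)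
    have nn: "0 \<le> y * y ^ a u" using y by simp
    have 1: "g (U - {u}) (advance a u w) w = k * (if min (a w) (Suc (a u)) < T then y ^ min (a w) (Suc (a u)) else 0)"
      using V by (simp add: g_def k_def advance_def)
    have 2: "g U a w = k * (if a w < T then y ^ a w else 0)" by (simp add: g_def k_def)
    show ?thesis
    proof (cases "a w \<le> Suc (a u)")
      case True
      then show ?thesis unfolding 1 2 using nn by (simp add: min_def)
    next
      case False
      have "k * (if Suc (a u) < T then y ^ Suc (a u) else 0) \<le> 1 * (y * y ^ a u)"
        using k nn by (intro mult_mono) auto
      moreover have "0 \<le> k * (if a w < T then y ^ a w else 0)" using k y by simp
      ultimately show ?thesis unfolding 1 2 using False by (simp add: min_def)
    qed
  qed
  ultimately show ?thesis by (simp add: algebra_simps)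
qed

text \<open>Invariant: vertices with clock at most \<open>T\<close> are informed in the lossy run.
  Each turn keeps the bound, by \<open>late_prob_advance\<close> for the first term and by the
  choice of \<open>\<rho>\<close> for the second. At the end, if some clock is below
  \<open>T\<close>, the second term is at least \<open>1\<close>. Otherwise all clocks have reached
  \<open>T\<close> and the first term accounts for a failure.\<close>

lemma lossy_push_fail_le:
  fixes \<Delta> y :: real
  assumes G: "simple_graph G" and d: "\<And>u. u \<in> verts G \<Longrightarrow> neighbors G u \<noteq> {}"
    and D: "0 \<le> \<Delta>" "\<Delta> \<le> 1" and y: "0 < y" "y \<le> 1" and \<rho>: "\<rho> = \<Delta> + 2 * y" "\<rho> \<le> 1"
    and "set us \<subseteq> verts G" "distinct us" "{z. a z \<le> T} \<subseteq> I" "I \<subseteq> verts G"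
  shows "push_fail (lossy_exp G \<Delta>) (verts G) r us A I
    \<le> late_prob G T a + \<rho> ^ r / y ^ T * clock_weight (verts G) T y \<rho> (set us \<inter> A) a"
  using assms(9-)
proof (induction "lossy_exp G \<Delta>" "verts G" r us A I arbitrary: a rule: push_fail.induct)
  case (1 A I)
  have fin: "finite (verts G)" using G by (simp add: simple_graph_def)
  have pow: "0 \<le> (if a u < T then y ^ a u else 0)" for u using y by simp
  have nn: "0 \<le> clock_weight (verts G) T y \<rho> U a" for U
    unfolding clock_weight_def using pow \<rho> D y by (intro sum_nonneg mult_nonneg_nonneg) auto
  show ?case
  proof (cases "I = verts G")
    case True
    then show ?thesis using nn late_prob_nonneg[of G T a] y by simp
  next
    case False
    show ?thesis
    proof (cases "\<exists>u\<in>verts G. a u < T")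
      case True
      then obtain u where u: "u \<in> verts G" "a u < T" by auto
      have "y ^ T \<le> y ^ a u" using u y by (intro power_decreasing) auto
      also have "\<dots> \<le> clock_weight (verts G) T y \<rho> {} a"
      proof -
        have "(if a u < T then y ^ a u else 0) \<le> (\<Sum>x\<in>verts G. if a x < T then y ^ a x else 0)"
          by (rule member_le_sum[OF u(1) pow fin])
        then show ?thesis using u by (simp add: clock_weight_def)
      qed
      finally have "1 \<le> clock_weight (verts G) T y \<rho> {} a / y ^ T" using y by simp
      then show ?thesis using False late_prob_nonneg[of G T a] by simp
    next
      case no: False
      have T: "T \<le> a z" for z
      proof (cases "z \<in> verts G")
        case True
        then show ?thesis using no by auto
      next
        case False
        then have "\<not> a z \<le> T" using 1 by auto
        then show ?thesis by simp
      qed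
      \<comment> \<open>No clock is below \<open>T\<close>, so nothing is active before time
        \<open>T\<close>, and at time \<open>T\<close> only vertices with clock \<open>T\<close>
        are. These lie in \<open>I\<close>, which is incomplete.\<close>
      have "\<not> verts G \<subseteq> active a c T" for c
      proof
        assume "verts G \<subseteq> active a c T"
        also have "active a c T \<subseteq> {z. a z \<le> T}"
        proof (cases T)
          case (Suc t)
          then have "active a c t = {}" using active_late[of T a t c] T by simp
          then show ?thesis using Suc by simp
        qed simp
        finally show False using 1 False by auto
      qed
      then have "late_prob G T a = 1" by (simp add: late_prob_def)
      then show ?thesis using False nn y by simp
    qed
  qed
next
  case (2 r A I)
  have L: "set (enum_list (verts G)) = verts G" "distinct (enum_list (verts G))"
    using enum_list[of "verts G"] G by (auto simp: simple_graph_def)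
  \<comment> \<open>Clocks below \<open>T\<close> belong to informed vertices, so every term takes
    the discount for the new round, which consumes one factor of
    \<open>\<rho> ^ Suc r\<close>.\<close>
  have "x \<in> I" if "a x < T" for x
    using 2(4) that by (meson less_imp_le mem_Collect_eq subsetD)
  then have "clock_weight (verts G) T y \<rho> (verts G \<inter> I) a = \<rho> * clock_weight (verts G) T y \<rho> {} a"
    unfolding clock_weight_def sum_distrib_left by (intro sum.cong) auto
  then show ?case using 2(1)[of a] 2 L by (simp add: mult_ac)
next
  case (3 r u us A I)
  have uV: "u \<in> verts G" and us: "set us \<subseteq> verts G" "distinct us" "u \<notin> set us" using 3 by auto
  have fin: "finite (verts G)" using G by (simp add: simple_graph_def)
  have nb: "neighbors G u \<noteq> {}" "finite (neighbors G u)" "neighbors G u \<subseteq> verts G" "u \<notin> neighbors G u"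
    using d[OF uV] finite_neighbors[OF G] G by (auto simp: simple_graph_def neighbors_def)
  show ?case
  proof (cases "u \<in> A")
    case False
    then show ?thesis using 3(2)[OF False us(1,2) 3(5,6)] by simp
  next
    case True
    define cf where "cf = \<rho> ^ r / y ^ T"
    define lf where "lf = (\<lambda>x. push_fail (lossy_exp G \<Delta>) (verts G) r us A (I \<union> set_option x))"
    define U where "U = set (u # us) \<inter> A"
    have Uu: "set us \<inter> A = U - {u}" using us by (auto simp: U_def)
    have "u \<in> U" using True by (simp add: U_def)
    have cf: "0 \<le> cf" unfolding cf_def using \<rho>(1) D y by simp
    have IH: "lf x \<le> late_prob G T b + cf * clock_weight (verts G) T y \<rho> (U - {u}) b"
      if "{z. b z \<le> T} \<subseteq> I \<union> set_option x" "set_option x \<subseteq> verts G" for x b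
      unfolding lf_def cf_def Uu[symmetric]
      by (rule 3(1)[OF True us(1,2)]) (use that 3 in auto)
    have goal: "push_fail (lossy_exp G \<Delta>) (verts G) r (u # us) A I = lossy_exp G \<Delta> u lf"
      using True by (simp add: lf_def)
    show ?thesis
    proof (cases "a u < T")
      case False
      \<comment> \<open>A clock at \<open>T\<close> or later carries no weight and is left alone.
        The push then only enlarges the informed set.\<close>
      have w: "clock_weight (verts G) T y \<rho> (U - {u}) a = clock_weight (verts G) T y \<rho> U a"
        unfolding clock_weight_def using False by (intro sum.cong) auto
      have "lossy_exp G \<Delta> u lf \<le> lossy_exp G \<Delta> u (\<lambda>_. late_prob G T a + cf * clock_weight (verts G) T y \<rho> (U - {u}) a)"
        using 3 nb by (intro lossy_exp_mono D IH) auto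
      then show ?thesis unfolding goal lossy_exp_const[OF nb(1,2)] w unfolding cf_def U_def .
    next
      case True
      define C where "C = clock_weight (verts G) T y \<rho> U a"
      define m where "m = real (card (neighbors G u))"
      have m: "0 < m" using nb by (simp add: m_def card_gt_0_iff)
      have None: "lf None \<le> late_prob G T a + cf * (C + (1 - \<rho>) * y ^ a u)"
        using IH[of a None] 3 clock_weight_process[where a=a and T=T and y=y and \<rho>=\<rho>, OF fin uV \<open>u \<in> U\<close> True] by (simp add: C_def)
      have Some: "lf (Some w) \<le> late_prob G T (advance a u w) + cf * (C + (2 * y - \<rho>) * y ^ a u)" if w: "w \<in> neighbors G u" for w
      proof -
        have wV: "w \<in> verts G" "u \<noteq> w" using w nb by auto
        have "lf (Some w) \<le> late_prob G T (advance a u w) + cf * clock_weight (verts G) T y \<rho> (U - {u}) (advance a u w)"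
        proof (rule IH)
          show "{z. advance a u w z \<le> T} \<subseteq> I \<union> set_option (Some w)"
          proof -
            have "u \<in> {z. a z \<le> T}" using True by simp
            then have "u \<in> I" using 3(5) by blast
            then show ?thesis using 3(5) by (auto simp: advance_def min_le_iff_disj split: if_splits)
          qed
        qed (use wV in simp)
        also have "\<dots> \<le> late_prob G T (advance a u w) + cf * (C + (2 * y - \<rho>) * y ^ a u)"
          unfolding C_def using clock_weight_advance[where a=a and T=T and y=y and \<rho>=\<rho>, OF fin uV wV(1,2) \<open>u \<in> U\<close> True] y \<rho> D cf
          by (intro add_left_mono mult_left_mono) auto
        finally show ?thesis .
      qed
      have "(\<Sum>w\<in>neighbors G u. lf (Some w)) / m
        \<le> (\<Sum>w\<in>neighbors G u. late_prob G T (advance a u w) + cf * (C + (2 * y - \<rho>) * y ^ a u)) / m"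
        using Some m by (intro divide_right_mono sum_mono) auto
      also have "\<dots> = (\<Sum>w\<in>neighbors G u. late_prob G T (advance a u w)) / m + cf * (C + (2 * y - \<rho>) * y ^ a u)"
        using m by (simp add: sum.distrib add_divide_distrib m_def[symmetric])
      also have "\<dots> \<le> late_prob G T a + cf * (C + (2 * y - \<rho>) * y ^ a u)"
        using late_prob_advance[where a=a and T=T, OF G uV nb(1) True] by (simp add: m_def)
      finally have avg: "(\<Sum>w\<in>neighbors G u. lf (Some w)) / m \<le> late_prob G T a + cf * (C + (2 * y - \<rho>) * y ^ a u)" .
      have "lossy_exp G \<Delta> u lf = \<Delta> * lf None + (1 - \<Delta>) * ((\<Sum>w\<in>neighbors G u. lf (Some w)) / m)"
        by (simp add: lossy_exp_def m_def)
      also have "\<dots> \<le> \<Delta> * (late_prob G T a + cf * (C + (1 - \<rho>) * y ^ a u))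
        + (1 - \<Delta>) * (late_prob G T a + cf * (C + (2 * y - \<rho>) * y ^ a u))"
        using None avg D by (intro add_mono mult_left_mono) auto
      also have "\<dots> = late_prob G T a + cf * C + cf * y ^ a u * (\<Delta> - \<rho> + (1 - \<Delta>) * (2 * y))"
        by (simp add: algebra_simps)
      \<comment> \<open>The bracket equals \<open>- 2 * y * \<Delta>\<close>, which explains the
        choice \<open>\<rho> = \<Delta> + 2 * y\<close>.\<close>
      also have "\<dots> \<le> late_prob G T a + cf * C + cf * y ^ a u * 0"
        using cf y D \<rho>(1) by (intro add_left_mono mult_left_mono) (auto simp: algebra_simps)
      finally show ?thesis unfolding goal cf_def C_def U_def by simp
    qed
  qed
qed

section \<open>Degree concentration and the finite estimate\<close>

text \<open>Keep-predicates in the support are false off the edge set, so they correspond to the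
  subsets of \<open>edges G\<close>.\<close>

lemma expectation_percolation:
  fixes f :: "'a ugraph \<Rightarrow> real"
  assumes G: "simple_graph G" and p: "0 \<le> p" "p \<le> 1"
  shows "measure_pmf.expectation (percolation G p) f
    = (\<Sum>F\<in>Pow (edges G). perc_weight p (edges G) F * f (edge_subgraph G F))"
proof -
  define E where "E = edges G"
  define P where "P = Pi_pmf E False (\<lambda>_. bernoulli_pmf p)"
  have fin: "finite E" unfolding E_def by (rule finite_edges[OF G])
  have "measure_pmf.expectation (percolation G p) f
    = measure_pmf.expectation P (\<lambda>k. f (edge_subgraph G {e \<in> E. k e}))"
    by (simp add: percolation_def P_def E_def edge_subgraph_def)
  also have "\<dots> = (\<Sum>k\<in>(\<lambda>F e. e \<in> F) ` Pow E. f (edge_subgraph G {e \<in> E. k e}) * pmf P k)"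
  proof (rule integral_measure_pmf_real)
    fix k assume "k \<in> set_pmf P"
    then have "\<forall>e. e \<notin> E \<longrightarrow> \<not> k e"
      using set_Pi_pmf_subset[OF fin] unfolding P_def by fastforce
    then have "k = (\<lambda>e. e \<in> {e. k e})" "{e. k e} \<in> Pow E" by auto
    then show "k \<in> (\<lambda>F e. e \<in> F) ` Pow E" by blast
  qed (use fin in simp)
  also have "\<dots> = (\<Sum>F\<in>Pow E. f (edge_subgraph G {e \<in> E. e \<in> F}) * pmf P (\<lambda>e. e \<in> F))"
    by (subst sum.reindex) (auto simp: inj_on_def fun_eq_iff)
  also have "\<dots> = (\<Sum>F\<in>Pow E. perc_weight p E F * f (edge_subgraph G F))"
  proof (intro sum.cong refl)
    fix F assume F: "F \<in> Pow E"
    have "pmf P (\<lambda>e. e \<in> F) = (\<Prod>e\<in>E. if e \<in> F then p else 1 - p)"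
      unfolding P_def using fin F p by (subst pmf_Pi') (auto intro!: prod.cong)
    also have "\<dots> = perc_weight p E F"
      using fin F by (simp add: prod.If_cases perc_weight_def Int_absorb1 Diff_eq[symmetric])
    finally have "pmf P (\<lambda>e. e \<in> F) = perc_weight p E F" .
    moreover have "{e \<in> E. e \<in> F} = F" using F by auto
    ultimately show "f (edge_subgraph G {e \<in> E. e \<in> F}) * pmf P (\<lambda>e. e \<in> F) = perc_weight p E F * f (edge_subgraph G F)"
      by simp
  qed
  finally show ?thesis unfolding E_def .
qed

lemma deg_in_eq_card_edges:
  assumes "simple_graph G" "F \<subseteq> edges G"
  shows "deg_in G F u = card {e \<in> F. u \<in> e}"
proof -
  have "bij_betw (\<lambda>w. {u, w}) (neighbors (edge_subgraph G F) u) {e \<in> F. u \<in> e}"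
  proof (rule bij_betwI')
    fix e assume e: "e \<in> {e \<in> F. u \<in> e}"
    then have "card e = 2" using assms by (auto simp: simple_graph_def)
    then obtain x y where "e = {x, y}" by (auto simp: card_2_iff)
    with e have "e = {u, x} \<or> e = {u, y}" by auto
    then show "\<exists>w\<in>neighbors (edge_subgraph G F) u. e = {u, w}"
      using e by (auto simp: neighbors_def)
  qed (auto simp: neighbors_def doubleton_eq_iff)
  then show ?thesis unfolding deg_in_def by (rule bij_betw_same_card)
qed

text \<open>The generating function of a binomial degree: the sum over subsets factorizes over the
  edges, and the edges away from \<open>u\<close> contribute the factor \<open>1\<close>.\<close>

lemma perc_weight_degree_pgf:
  fixes s p :: real
  assumes G: "simple_graph G"
  shows "(\<Sum>F\<in>Pow (edges G). perc_weight p (edges G) F * s ^ deg_in G F u) = (1 - p + p * s) ^ card (neighbors G u)"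
proof -
  define E where "E = edges G"
  have fin: "finite E" unfolding E_def by (rule finite_edges[OF G])
  have "(\<Sum>F\<in>Pow E. perc_weight p E F * s ^ deg_in G F u)
    = (\<Sum>F\<in>Pow E. (\<Prod>e\<in>F. p * (if u \<in> e then s else 1)) * (\<Prod>e\<in>E - F. 1 - p))"
  proof (intro sum.cong refl)
    fix F assume F: "F \<in> Pow E"
    then have "finite F" using fin finite_subset by auto
    then have "(\<Prod>e\<in>F. p * (if u \<in> e then s else 1)) = p ^ card F * s ^ card {e \<in> F. u \<in> e}"
      by (simp add: prod.distrib prod.If_cases Int_def)
    then show "perc_weight p E F * s ^ deg_in G F u
      = (\<Prod>e\<in>F. p * (if u \<in> e then s else 1)) * (\<Prod>e\<in>E - F. 1 - p)"
      using F deg_in_eq_card_edges[OF G, of F u] by (simp add: perc_weight_def E_def)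
  qed
  also have "\<dots> = (\<Prod>e\<in>E. p * (if u \<in> e then s else 1) + (1 - p))"
    by (rule prod_add[OF fin, symmetric])
  also have "\<dots> = (\<Prod>e\<in>E. if u \<in> e then 1 - p + p * s else 1)"
    by (intro prod.cong) auto
  also have "\<dots> = (1 - p + p * s) ^ card {e \<in> E. u \<in> e}"
    using fin by (simp add: prod.If_cases Int_def)
  also have "card {e \<in> E. u \<in> e} = deg_in G E u"
    using deg_in_eq_card_edges[OF G, of E u] by (simp add: E_def)
  also have "deg_in G E u = card (neighbors G u)"
    by (simp add: deg_in_def E_def neighbors_def)
  finally show ?thesis unfolding E_def .
qed

lemma sum_perc_weight: "simple_graph G \<Longrightarrow> (\<Sum>F\<in>Pow (edges G). perc_weight p (edges G) F) = 1"
  using perc_weight_degree_pgf[of G p 1] by simp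

text \<open>Markov's inequality for the exponential of \<open>l\<close> times the degree. The sign
  of \<open>l\<close> is left open and the bound on \<open>exp l\<close> is a hypothesis, so that
  both tails are covered.\<close>

lemma degree_exponential_moment:
  fixes l \<mu> p :: real
  assumes G: "simple_graph G" and p: "0 \<le> p" "p \<le> 1" and \<mu>: "\<mu> = p * card (neighbors G u)"
    and l: "exp l \<le> 1 + l + l\<^sup>2"
    and tail: "\<And>F. tail F \<Longrightarrow> c \<le> l * deg_in G F u"
  shows "(\<Sum>F\<in>Pow (edges G). of_bool (tail F) * perc_weight p (edges G) F) \<le> exp (\<mu> * (l + l\<^sup>2) - c)"
proof -
  have "(\<Sum>F\<in>Pow (edges G). of_bool (tail F) * perc_weight p (edges G) F)
    \<le> (\<Sum>F\<in>Pow (edges G). exp (- c) * (perc_weight p (edges G) F * exp l ^ deg_in G F u))"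
  proof (intro sum_mono)
    fix F
    have "of_bool (tail F) \<le> exp (l * deg_in G F u - c)"
      using tail[of F] by (simp add: of_bool_def)
    also have "\<dots> = exp (- c) * exp l ^ deg_in G F u"
      by (simp add: exp_diff exp_minus exp_of_nat_mult[symmetric] mult.commute divide_inverse)
    finally have "of_bool (tail F) * perc_weight p (edges G) F \<le> exp (- c) * exp l ^ deg_in G F u * perc_weight p (edges G) F"
      using perc_weight_nonneg[OF p] by (intro mult_right_mono) auto
    then show "of_bool (tail F) * perc_weight p (edges G) F \<le> exp (- c) * (perc_weight p (edges G) F * exp l ^ deg_in G F u)"
      by (simp add: mult_ac)
  qed
  also have "\<dots> = exp (- c) * (1 - p + p * exp l) ^ card (neighbors G u)"
    unfolding sum_distrib_left[symmetric] perc_weight_degree_pgf[OF G] ..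
  also have "\<dots> \<le> exp (- c) * exp (\<mu> * (l + l\<^sup>2))"
  proof (intro mult_left_mono)
    have "p * (exp l - 1) \<le> p * (l + l\<^sup>2)" using p l by (intro mult_left_mono) auto
    then have "1 - p + p * exp l \<le> 1 + p * (l + l\<^sup>2)" by (simp add: algebra_simps)
    also have "\<dots> \<le> exp (p * (l + l\<^sup>2))" by (rule exp_ge_add_one_self)
    finally have "(1 - p + p * exp l) ^ card (neighbors G u) \<le> exp (p * (l + l\<^sup>2)) ^ card (neighbors G u)"
      using p by (intro power_mono) auto
    also have "\<dots> = exp (\<mu> * (l + l\<^sup>2))"
      by (simp add: \<mu> exp_of_nat_mult[symmetric] mult_ac)
    finally show "(1 - p + p * exp l) ^ card (neighbors G u) \<le> exp (\<mu> * (l + l\<^sup>2))" .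
  qed simp
  also have "\<dots> = exp (\<mu> * (l + l\<^sup>2) - c)" by (simp add: exp_diff exp_minus divide_inverse)
  finally show ?thesis .
qed

text \<open>The parameters \<open>l = \<delta> / 2\<close> and \<open>l = - (\<delta> / 2)\<close>
  both lead to the exponent
  \<open>\<mu> * (\<delta>\<^sup>2 / 4 - \<delta>\<^sup>2 / 2)\<close>.\<close>

lemma degree_concentration:
  fixes \<delta> \<mu> p :: real
  assumes G: "simple_graph G" and p: "0 \<le> p" "p \<le> 1" and \<mu>: "\<mu> = p * card (neighbors G u)"
    and \<delta>: "0 \<le> \<delta>" "\<delta> \<le> 1"
  shows "(\<Sum>F\<in>Pow (edges G). of_bool (deg_in G F u < (1 - \<delta>) * \<mu> \<or> deg_in G F u > (1 + \<delta>) * \<mu>) * perc_weight p (edges G) F)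
    \<le> 2 * exp (- \<delta>\<^sup>2 * \<mu> / 4)"
proof -
  have up: "(\<Sum>F\<in>Pow (edges G). of_bool (deg_in G F u > (1 + \<delta>) * \<mu>) * perc_weight p (edges G) F)
    \<le> exp (\<mu> * (\<delta> / 2 + (\<delta> / 2)\<^sup>2) - \<delta> / 2 * ((1 + \<delta>) * \<mu>))"
    using \<delta> by (intro degree_exponential_moment[OF G p \<mu>] exp_bound mult_left_mono) auto
  have low: "(\<Sum>F\<in>Pow (edges G). of_bool (deg_in G F u < (1 - \<delta>) * \<mu>) * perc_weight p (edges G) F)
    \<le> exp (\<mu> * (- (\<delta> / 2) + (- (\<delta> / 2))\<^sup>2) - (- (\<delta> / 2)) * ((1 - \<delta>) * \<mu>))"
  proof (rule degree_exponential_moment[OF G p \<mu>])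
    define l where "l = \<delta> / 2"
    have l: "0 \<le> l" using \<delta> by (simp add: l_def)
    have "exp (- l) = 1 / exp l" by (simp add: exp_minus divide_inverse)
    also have "\<dots> \<le> 1 / (1 + l)" using l by (intro divide_left_mono exp_ge_add_one_self) auto
    also have "\<dots> \<le> 1 - l + l\<^sup>2"
    proof -
      have "(1 - l + l\<^sup>2) * (1 + l) = 1 + l ^ 3" by (simp add: algebra_simps power2_eq_square power3_eq_cube)
      then have "1 \<le> (1 - l + l\<^sup>2) * (1 + l)" using l by simp
      then show ?thesis using l by (simp add: divide_le_eq)
    qed
    finally show "exp (- (\<delta> / 2)) \<le> 1 + - (\<delta> / 2) + (- (\<delta> / 2))\<^sup>2" by (simp add: l_def)
    show "- (\<delta> / 2) * ((1 - \<delta>) * \<mu>) \<le> - (\<delta> / 2) * deg_in G F u" if "deg_in G F u < (1 - \<delta>) * \<mu>" for F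
      using \<delta> that by (intro mult_left_mono_neg) auto
  qed
  have "(\<Sum>F\<in>Pow (edges G). of_bool (deg_in G F u < (1 - \<delta>) * \<mu> \<or> deg_in G F u > (1 + \<delta>) * \<mu>) * perc_weight p (edges G) F)
    \<le> (\<Sum>F\<in>Pow (edges G). of_bool (deg_in G F u < (1 - \<delta>) * \<mu>) * perc_weight p (edges G) F
        + of_bool (deg_in G F u > (1 + \<delta>) * \<mu>) * perc_weight p (edges G) F)"
    using perc_weight_nonneg[OF p] by (intro sum_mono) auto
  also have "\<dots> \<le> exp (- \<delta>\<^sup>2 * \<mu> / 4) + exp (- \<delta>\<^sup>2 * \<mu> / 4)"
    unfolding sum.distrib
    using up low by (intro add_mono) (simp_all add: power2_eq_square field_simps)
  finally show ?thesis by simp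
qed

section \<open>Assembling the finite estimate\<close>

lemma card_informed: "finite (informed v c t) \<and> card (informed v c t) \<le> 2 ^ t"
proof (induction t)
  case (Suc t)
  \<comment> \<open>\<open>the None\<close> may add one unspecified element to the image, which does
    not affect the doubling bound.\<close>
  have sub: "informed v c (Suc t) \<subseteq> informed v c t \<union> (\<lambda>u. the (c (t, u))) ` informed v c t"
    by (force simp: image_iff)
  have fin: "finite (informed v c t \<union> (\<lambda>u. the (c (t, u))) ` informed v c t)"
    using Suc by simp
  have "card (informed v c (Suc t)) \<le> card (informed v c t \<union> (\<lambda>u. the (c (t, u))) ` informed v c t)"
    by (rule card_mono[OF fin sub])
  also have "\<dots> \<le> card (informed v c t) + card (informed v c t)"
    using card_Un_le card_image_le Suc by (meson add_left_mono le_trans)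
  also have "\<dots> \<le> 2 ^ Suc t" using Suc by simp
  finally show ?case using finite_subset[OF sub fin] by blast
qed simp

lemma late_prob_init:
  assumes G: "simple_graph G" and v: "v \<in> verts G"
  shows "late_prob G T (\<lambda>z. if z = v then 0 else Suc T)
    = 1 - measure_pmf.prob (push_choices G T) {c. informed v c T = verts G}"
proof -
  have "late_prob G T (\<lambda>z. if z = v then 0 else Suc T)
    = measure_pmf.expectation (push_choices G T) (indicator {c. \<not> verts G \<subseteq> informed v c T})"
    unfolding late_prob_def by (intro arg_cong[where f="measure_pmf.expectation _"]) (auto simp: active_informed fun_eq_iff)
  also have "\<dots> = measure_pmf.prob (push_choices G T) {c. \<not> verts G \<subseteq> informed v c T}" by simp
  also have "\<dots> = measure_pmf.prob (push_choices G T) {c. informed v c T \<noteq> verts G}"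
  proof (rule measure_prob_cong_0)
    fix c assume *: "c \<in> {c. informed v c T \<noteq> verts G} - {c. \<not> verts G \<subseteq> informed v c T}"
    { assume c: "c \<in> set_pmf (push_choices G T)"
      have "informed v c T = informed v c T \<and> informed v c T \<subseteq> verts G"
        by (rule informed_cong) (use v push_choices_verts[OF G c] in auto)
      with * have False by auto }
    then show "pmf (push_choices G T) c = 0" by (auto simp: set_pmf_eq)
  qed auto
  also have "\<dots> = 1 - measure_pmf.prob (push_choices G T) {c. informed v c T = verts G}"
    using measure_pmf.prob_compl[of "{c. informed v c T = verts G}" "push_choices G T"]
    by (simp add: Compl_eq_Diff_UNIV[symmetric] Compl_eq)
  finally show ?thesis .
qed

lemma measure_percolated_runtime:
  assumes G: "simple_graph G" and v: "v \<in> verts G" and p: "0 \<le> p" "p \<le> 1" and x: "0 \<le> x"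
  shows "1 - measure (percolated_runtime_law G p v) {\<tau> \<in> space (percolated_runtime_law G p v). ereal_of_enat \<tau> \<le> ereal x}
    = (\<Sum>F\<in>Pow (edges G). perc_weight p (edges G) F * push_fail (choice_exp (edge_subgraph G F)) (verts G) (nat \<lfloor>x\<rfloor>) [] {v} {v})"
proof -
  have sp: "space (runtime_law H v) = UNIV" for H by (simp add: runtime_law_def)
  have "space (percolated_runtime_law G p v) = space (count_space UNIV :: enat measure)"
    unfolding percolated_runtime_law_def by (rule space_bind) (simp_all add: runtime_law_def)
  then have "measure (percolated_runtime_law G p v) {\<tau> \<in> space (percolated_runtime_law G p v). ereal_of_enat \<tau> \<le> ereal x}
    = measure_pmf.expectation (percolation G p) (\<lambda>H. measure (runtime_law H v) {\<tau>. ereal_of_enat \<tau> \<le> ereal x})"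
    by (simp add: measure_percolated_runtime_law)
  also have "\<dots> = (\<Sum>F\<in>Pow (edges G). perc_weight p (edges G) F
      * measure (runtime_law (edge_subgraph G F) v) {\<tau>. ereal_of_enat \<tau> \<le> ereal x})"
    by (rule expectation_percolation[OF G p])
  also have "\<dots> = (\<Sum>F\<in>Pow (edges G). perc_weight p (edges G) F
      - perc_weight p (edges G) F * push_fail (choice_exp (edge_subgraph G F)) (verts G) (nat \<lfloor>x\<rfloor>) [] {v} {v})"
  proof (intro sum.cong refl)
    fix F assume "F \<in> Pow (edges G)"
    then have H: "simple_graph (edge_subgraph G F)" using simple_edge_subgraph[OF G] by simp
    have m: "measure (runtime_law (edge_subgraph G F) v) {\<tau>. ereal_of_enat \<tau> \<le> ereal x}
      = 1 - push_fail (choice_exp (edge_subgraph G F)) (verts G) (nat \<lfloor>x\<rfloor>) [] {v} {v}"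
      using measure_runtime_law[OF H _ x, of v] prob_push_choices[OF H, of v] v by (simp add: sp)
    show "perc_weight p (edges G) F * measure (runtime_law (edge_subgraph G F) v) {\<tau>. ereal_of_enat \<tau> \<le> ereal x}
      = perc_weight p (edges G) F - perc_weight p (edges G) F * push_fail (choice_exp (edge_subgraph G F)) (verts G) (nat \<lfloor>x\<rfloor>) [] {v} {v}"
      unfolding m by (simp add: algebra_simps)
  qed
  finally show ?thesis by (simp add: sum_subtractf sum_perc_weight[OF G])
qed

text \<open>Three error terms: the lossless protocol on \<open>G\<close> fails by time
  \<open>x\<close>, some lossy clock stays below its horizon, or some degree is irregular, the
  latter by a union bound over the vertices.\<close>

lemma percolated_runtime_tail:
  fixes p \<delta> \<Delta> x x' :: real and d :: nat
  assumes G: "simple_graph G" and reg: "regular_graph d G" and v: "v \<in> verts G" and p: "0 < p" "p \<le> 1" and dpos: "0 < d"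
    and x: "0 \<le> x" "0 \<le> x'" and \<delta>: "0 < \<delta>" "\<delta> < 1" and D: "0 \<le> \<Delta>" "\<Delta> \<le> 1" and y: "0 < y" "y \<le> 1" and \<rho>: "\<Delta> + 2 * y \<le> 1"
  defines "\<mu> \<equiv> p * d"
  assumes step: "(1 - \<Delta>) / d \<le> p * ((1 - \<delta>) * \<mu> / ((1 - \<delta>) * \<mu> + 1)) ^ nat \<lfloor>x'\<rfloor> / ((1 + \<delta>) * \<mu> + 1) * (1 - \<delta>)"
  shows "1 - measure (percolated_runtime_law G p v) {\<tau> \<in> space (percolated_runtime_law G p v). ereal_of_enat \<tau> \<le> ereal x'}
    \<le> (1 - measure (runtime_law G v) {\<tau> \<in> space (runtime_law G v). ereal_of_enat \<tau> \<le> ereal x})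
      + (\<Delta> + 2 * y) ^ nat \<lfloor>x'\<rfloor> / y ^ nat \<lfloor>x\<rfloor> + 2 * card (verts G) * exp (- \<delta>\<^sup>2 * \<mu> / 4) / \<delta>"
proof -
  define N where "N = nat \<lfloor>x'\<rfloor>"
  define T where "T = nat \<lfloor>x\<rfloor>"
  define lo where "lo = (1 - \<delta>) * \<mu>"
  define hi where "hi = (1 + \<delta>) * \<mu>"
  define a where "a = (\<lambda>z. if z = v then 0 else Suc T)"
  define bad where "bad F \<longleftrightarrow> (\<exists>u\<in>verts G. deg_in G F u < lo \<or> deg_in G F u > hi)" for F
  have d: "card (neighbors G u) = d" if "u \<in> verts G" for u
    using reg that by (simp add: regular_graph_def)
  have nb: "neighbors G u \<noteq> {}" if "u \<in> verts G" for u
    using d[OF that] dpos by auto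
  have fin: "finite (verts G)" using G by (simp add: simple_graph_def)
  have \<mu>: "0 < \<mu>" using p dpos by (simp add: \<mu>_def)
  have lo: "0 < lo" and hi: "0 \<le> hi" using \<mu> \<delta> by (simp_all add: lo_def hi_def)
  have pp: "0 \<le> p" "p \<le> 1" using p by auto
  have "1 - measure (percolated_runtime_law G p v) {\<tau> \<in> space (percolated_runtime_law G p v). ereal_of_enat \<tau> \<le> ereal x'}
    = (\<Sum>F\<in>Pow (edges G). perc_weight p (edges G) F * 1 * push_fail (choice_exp (edge_subgraph G F)) (verts G) N [] {v} {v})"
    using measure_percolated_runtime[OF G v pp x(2)] by (simp add: N_def)
  also have "\<dots> \<le> push_fail (lossy_exp G \<Delta>) (verts G) N [] {v} {v} * (\<Sum>F\<in>Pow (edges G). perc_weight p (edges G) F * 1)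
      + (\<Sum>F\<in>Pow (edges G). of_bool (\<exists>u\<in>verts G. deg_in G F u < lo \<or> deg_in G F u > hi) * (perc_weight p (edges G) F * 1)) / \<delta>"
  proof (rule percolated_push_fail_le_lossy[OF G nb pp D \<delta>(1) lo hi])
    show "0 < lo / (lo + 1)" using lo by simp
    show "(1 - \<Delta>) / card (neighbors G u) \<le> p * (lo / (lo + 1)) ^ N / (hi + 1) * (1 - \<delta>)" if "u \<in> verts G" for u
      using step d[OF that] by (simp add: lo_def hi_def N_def)
    \<comment> \<open>Before the first push the likelihood is constantly \<open>1\<close> and nobody
      has pushed.\<close>
    show "weight_bump G lo (lo / (lo + 1)) (\<lambda>_. 1) (\<lambda>_. 0) {v}" by (simp add: weight_bump_def)
  qed (use v in auto)
  also have "(\<Sum>F\<in>Pow (edges G). perc_weight p (edges G) F * 1) = 1"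
    by (simp add: sum_perc_weight[OF G])
  also have "push_fail (lossy_exp G \<Delta>) (verts G) N [] {v} {v} * 1 \<le> late_prob G T a + (\<Delta> + 2 * y) ^ N / y ^ T"
  proof -
    have "push_fail (lossy_exp G \<Delta>) (verts G) N [] {v} {v}
      \<le> late_prob G T a + (\<Delta> + 2 * y) ^ N / y ^ T * clock_weight (verts G) T y (\<Delta> + 2 * y) (set [] \<inter> {v}) a"
      by (rule lossy_push_fail_le[OF G nb D y refl \<rho>]) (use v in \<open>auto simp: a_def split: if_splits\<close>)
    also have "\<dots> \<le> late_prob G T a + (\<Delta> + 2 * y) ^ N / y ^ T * 1"
    proof (intro add_left_mono mult_left_mono)
      \<comment> \<open>At the start only \<open>v\<close>, with clock \<open>0\<close>, can be
        below \<open>T\<close>; all other clocks are \<open>Suc T\<close>.\<close>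
      have "clock_weight (verts G) T y (\<Delta> + 2 * y) (set [] \<inter> {v}) a = (\<Sum>u\<in>verts G. if u = v then of_bool (0 < T) else 0)"
        unfolding clock_weight_def by (intro sum.cong) (auto simp: a_def)
      also have "\<dots> \<le> 1" using fin v by simp
      finally show "clock_weight (verts G) T y (\<Delta> + 2 * y) (set [] \<inter> {v}) a \<le> 1" .
    qed (use D y in simp)
    finally show ?thesis by simp
  qed
  also have "late_prob G T a = 1 - measure (runtime_law G v) {\<tau> \<in> space (runtime_law G v). ereal_of_enat \<tau> \<le> ereal x}"
    using late_prob_init[OF G v, of T] measure_runtime_law[OF G v x(1)] by (simp add: a_def T_def)
  also have "(\<Sum>F\<in>Pow (edges G). of_bool (\<exists>u\<in>verts G. deg_in G F u < lo \<or> deg_in G F u > hi) * (perc_weight p (edges G) F * 1)) / \<delta>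
    \<le> 2 * card (verts G) * exp (- \<delta>\<^sup>2 * \<mu> / 4) / \<delta>"
  proof (rule divide_right_mono)
    have "(\<Sum>F\<in>Pow (edges G). of_bool (\<exists>u\<in>verts G. deg_in G F u < lo \<or> deg_in G F u > hi) * (perc_weight p (edges G) F * 1))
      \<le> (\<Sum>F\<in>Pow (edges G). \<Sum>u\<in>verts G. of_bool (deg_in G F u < lo \<or> deg_in G F u > hi) * perc_weight p (edges G) F)"
    proof (rule sum_mono)
      fix F
      have w: "0 \<le> perc_weight p (edges G) F" by (rule perc_weight_nonneg[OF pp])
      show "of_bool (\<exists>u\<in>verts G. deg_in G F u < lo \<or> deg_in G F u > hi) * (perc_weight p (edges G) F * 1)
        \<le> (\<Sum>u\<in>verts G. of_bool (deg_in G F u < lo \<or> deg_in G F u > hi) * perc_weight p (edges G) F)"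
      proof (cases "\<exists>u\<in>verts G. deg_in G F u < lo \<or> deg_in G F u > hi")
        case True
        then obtain u where u: "u \<in> verts G" "deg_in G F u < lo \<or> deg_in G F u > hi" by auto
        have "of_bool (deg_in G F u < lo \<or> deg_in G F u > hi) * perc_weight p (edges G) F
          \<le> (\<Sum>u\<in>verts G. of_bool (deg_in G F u < lo \<or> deg_in G F u > hi) * perc_weight p (edges G) F)"
          by (rule member_le_sum[OF u(1)]) (use w fin in auto)
        moreover have "of_bool (deg_in G F u < lo \<or> deg_in G F u > hi) = (1::real)" using u(2) by simp
        ultimately show ?thesis using True by simp
      next
        case False
        then show ?thesis using w by (simp add: sum_nonneg)
      qed
    qed
    also have "\<dots> = (\<Sum>u\<in>verts G. \<Sum>F\<in>Pow (edges G). of_bool (deg_in G F u < lo \<or> deg_in G F u > hi) * perc_weight p (edges G) F)"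
      by (rule sum.swap)
    also have "\<dots> \<le> (\<Sum>u\<in>verts G. 2 * exp (- \<delta>\<^sup>2 * \<mu> / 4))"
      unfolding lo_def hi_def
      by (intro sum_mono degree_concentration[OF G pp]) (use d \<delta> in \<open>auto simp: \<mu>_def\<close>)
    finally show "(\<Sum>F\<in>Pow (edges G). of_bool (\<exists>u\<in>verts G. deg_in G F u < lo \<or> deg_in G F u > hi) * (perc_weight p (edges G) F * 1))
      \<le> 2 * card (verts G) * exp (- \<delta>\<^sup>2 * \<mu> / 4)" by (simp add: mult_ac)
  qed (use \<delta> in simp)
  finally show ?thesis unfolding N_def T_def by simp
qed

text \<open>Positive probability yields one sequence of choices that informs every vertex in time,
  and informed sets at most double per round.\<close>

lemma card_verts_le_of_runtime:
  assumes G: "simple_graph G" and v: "v \<in> verts G" and x: "0 \<le> x"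
    and pos: "0 < measure (runtime_law G v) {\<tau> \<in> space (runtime_law G v). ereal_of_enat \<tau> \<le> ereal x}"
  shows "card (verts G) \<le> 2 ^ nat \<lfloor>x\<rfloor>"
proof -
  have "measure_pmf.prob (push_choices G (nat \<lfloor>x\<rfloor>)) {c. informed v c (nat \<lfloor>x\<rfloor>) = verts G} \<noteq> 0"
    using pos measure_runtime_law[OF G v x] by simp
  then have "{c. informed v c (nat \<lfloor>x\<rfloor>) = verts G} \<noteq> {}" by (metis measure_empty)
  then obtain c where "informed v c (nat \<lfloor>x\<rfloor>) = verts G" by blast
  then show ?thesis using card_informed[of v c "nat \<lfloor>x\<rfloor>"] by simp
qed

section \<open>Asymptotics\<close>

lemma eventually_sizes_at_top:
  "eventually P (sizes_at_top S) \<longleftrightarrow> eventually (\<lambda>n. n \<in> S \<longrightarrow> P n) sequentially"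
  by (simp add: sizes_at_top_def eventually_inf_principal)

text \<open>The loss \<open>4 * \<delta>\<close> collects a factor \<open>1 - \<delta>\<close> for
  irregular edge sets, another \<open>1 - \<delta>\<close> for the power of the likelihood ratio by
  Bernoulli's inequality, and a divisor \<open>1 + 2 * \<delta>\<close> for the largest degree plus
  one, where \<open>1 \<le> \<delta> * \<mu>\<close> absorbs the summand \<open>1\<close>.\<close>

lemma pick_rate_lower_bound:
  fixes p \<delta> \<mu> :: real and d N :: nat
  assumes p: "0 < p" and \<mu>: "\<mu> = p * d" "1 \<le> \<delta> * \<mu>" and \<delta>: "0 < \<delta>" "\<delta> < 1"
    and N: "N \<le> \<delta> * ((1 - \<delta>) * \<mu>)"
  shows "(1 - 4 * \<delta>) / d \<le> p * ((1 - \<delta>) * \<mu> / ((1 - \<delta>) * \<mu> + 1)) ^ N / ((1 + \<delta>) * \<mu> + 1) * (1 - \<delta>)"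
proof -
  define lo where "lo = (1 - \<delta>) * \<mu>"
  have \<mu>0: "0 < \<mu>" using \<mu>(2) \<delta> by (smt (verit) mult_nonneg_nonpos)
  have lo: "0 < lo" using \<mu>0 \<delta> by (simp add: lo_def)
  have d: "0 < real d" using \<mu>0 \<mu>(1) p by (simp add: zero_less_mult_iff)
  have "1 - \<delta> \<le> 1 + real N * (lo / (lo + 1) - 1)"
  proof -
    have "real N * (1 / (lo + 1)) \<le> \<delta> * lo * (1 / (lo + 1))"
      using N lo by (intro mult_right_mono) (auto simp: lo_def)
    also have "\<dots> \<le> \<delta>" using lo \<delta> by (simp add: field_simps)
    finally have "real N * (1 / (lo + 1)) \<le> \<delta>" .
    moreover have "lo / (lo + 1) - 1 = - (1 / (lo + 1))" using lo by (simp add: field_simps)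
    ultimately show ?thesis by simp
  qed
  also have "\<dots> \<le> (1 + (lo / (lo + 1) - 1)) ^ N"
    using lo by (intro Bernoulli_inequality) simp
  finally have pow: "1 - \<delta> \<le> (lo / (lo + 1)) ^ N" by simp
  have "(1 - 4 * \<delta>) * (1 + 2 * \<delta>) \<le> (1 - \<delta>) * (1 - \<delta>)"
  proof -
    have "(1 - \<delta>) * (1 - \<delta>) - (1 - 4 * \<delta>) * (1 + 2 * \<delta>) = 9 * \<delta>\<^sup>2"
      by (simp add: algebra_simps power2_eq_square)
    then show ?thesis by (smt (verit) zero_le_power2)
  qed
  then have "1 - 4 * \<delta> \<le> (1 - \<delta>) * (1 - \<delta>) / (1 + 2 * \<delta>)"
    using \<delta> by (simp add: field_simps)
  then have "(1 - 4 * \<delta>) / d \<le> (1 - \<delta>) * (1 - \<delta>) / (1 + 2 * \<delta>) / d"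
    using d by (intro divide_right_mono) auto
  also have "\<dots> = p * (1 - \<delta>) / ((1 + 2 * \<delta>) * \<mu>) * (1 - \<delta>)"
  proof -
    have "(1 + 2 * \<delta>) * \<mu> = p * ((1 + 2 * \<delta>) * d)" by (simp add: \<mu>(1) mult_ac)
    then have "p * (1 - \<delta>) / ((1 + 2 * \<delta>) * \<mu>) = (1 - \<delta>) / ((1 + 2 * \<delta>) * d)"
      using p by (simp only:) simp
    then show ?thesis by simp
  qed
  also have "\<dots> \<le> p * (1 - \<delta>) / ((1 + \<delta>) * \<mu> + 1) * (1 - \<delta>)"
  proof (intro mult_right_mono divide_left_mono)
    show "(1 + \<delta>) * \<mu> + 1 \<le> (1 + 2 * \<delta>) * \<mu>" using \<mu>(2) by (simp add: algebra_simps)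
    show "0 < (1 + 2 * \<delta>) * \<mu> * ((1 + \<delta>) * \<mu> + 1)"
      using \<mu>0 \<delta> by (intro mult_pos_pos add_pos_pos) auto
  qed (use p \<delta> in auto)
  also have "\<dots> \<le> p * (lo / (lo + 1)) ^ N / ((1 + \<delta>) * \<mu> + 1) * (1 - \<delta>)"
    using pow p \<delta> \<mu>0 by (intro mult_right_mono divide_right_mono mult_left_mono) auto
  finally show ?thesis unfolding lo_def .
qed

lemma runtime_bound_nonneg:
  assumes "measure M {\<tau> \<in> space M. ereal_of_enat \<tau> \<le> ereal x} > 0"
  shows "0 \<le> x"
proof -
  have "{\<tau> \<in> space M. ereal_of_enat \<tau> \<le> ereal x} \<noteq> {}" using assms by (metis less_irrefl measure_empty)
  then obtain \<tau> where "ereal_of_enat \<tau> \<le> ereal x" by auto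
  then have "ereal 0 \<le> ereal x"
    using ereal_of_enat_ge_zero_cancel_iff[of \<tau>] by (metis order_trans zero_ereal_def zero_le)
  then show ?thesis by simp
qed

text \<open>With \<open>\<rho> = (1 / 8) ^ K\<close> and \<open>y = \<rho> / 4\<close>, the first
  \<open>N\<close> rounds leave a factor \<open>4 ^ N\<close>. The \<open>M\<close> extra rounds
  satisfy \<open>K * M \<ge> N\<close> and gain \<open>\<rho> ^ M \<le> (1 / 8) ^ N\<close>.\<close>

lemma slowed_push_tail:
  fixes \<epsilon> x :: real and K :: nat
  assumes K: "2 \<le> \<epsilon> * K" and \<epsilon>: "0 < \<epsilon>" and x: "0 \<le> x" and N: "1 \<le> \<epsilon> / 2 * nat \<lfloor>x\<rfloor>"
  shows "((1 / 8) ^ K) ^ nat \<lfloor>(1 + \<epsilon>) * x\<rfloor> / ((1 / 8) ^ K / 4) ^ nat \<lfloor>x\<rfloor> \<le> (1 / 2 :: real) ^ nat \<lfloor>x\<rfloor>"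
proof -
  define N where "N = nat \<lfloor>x\<rfloor>"
  define M where "M = nat \<lfloor>(1 + \<epsilon>) * x\<rfloor> - N"
  define \<rho> where "\<rho> = (1 / 8 :: real) ^ K"
  have Nx: "real N \<le> x" using x by (simp add: N_def)
  have "real N + \<epsilon> * N \<le> (1 + \<epsilon>) * x"
    using mult_left_mono[OF Nx, of "1 + \<epsilon>"] \<epsilon> by (simp add: algebra_simps)
  \<comment> \<open>Rounding costs at most one round, and \<open>1 \<le> \<epsilon> / 2 * N\<close>
    leaves half of the \<open>\<epsilon> * N\<close> extra rounds.\<close>
  then have MN: "real N + \<epsilon> * N - 1 \<le> nat \<lfloor>(1 + \<epsilon>) * x\<rfloor>" by linarith
  have N1: "1 \<le> \<epsilon> / 2 * N" using N by (simp add: N_def)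
  then have sum: "nat \<lfloor>(1 + \<epsilon>) * x\<rfloor> = N + M" using MN unfolding M_def by linarith
  have "\<epsilon> / 2 * N \<le> M" using MN N1 sum by (simp add: algebra_simps)
  then have "real K * (\<epsilon> / 2 * N) \<le> real K * M" by (intro mult_left_mono) auto
  moreover have "real N \<le> real K * (\<epsilon> / 2 * N)"
    using mult_right_mono[OF K, of "real N / 2"] by (simp add: mult_ac)
  ultimately have KM: "N \<le> K * M" by (metis (mono_tags) of_nat_mult of_nat_le_iff order_trans)
  have \<rho>: "0 < \<rho>" by (simp add: \<rho>_def)
  have "\<rho> ^ (N + M) / (\<rho> / 4) ^ N = 4 ^ N * \<rho> ^ M"
    using \<rho> by (simp add: power_add power_divide)
  also have "\<rho> ^ M = (1 / 8) ^ (K * M)" by (simp add: \<rho>_def power_mult)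
  also have "4 ^ N * \<dots> \<le> 4 ^ N * (1 / 8 :: real) ^ N"
    using KM by (intro mult_left_mono power_decreasing) auto
  also have "\<dots> = (1 / 2) ^ N" by (simp add: power_mult_distrib[symmetric])
  finally show ?thesis unfolding sum by (simp add: \<rho>_def N_def)
qed

theorem theorem1p1:
  fixes S :: "nat set" and G :: "nat \<Rightarrow> 'a ugraph" and d :: "nat \<Rightarrow> nat"
    and v :: "nat \<Rightarrow> 'a" and T p :: "nat \<Rightarrow> real" and \<epsilon> :: real
  assumes "infinite S"
    and "\<And>n. n \<in> S \<Longrightarrow> simple_graph (G n)"
    and "\<And>n. n \<in> S \<Longrightarrow> card (verts (G n)) = n"
    and "\<And>n. n \<in> S \<Longrightarrow> connected_graph (G n)"
    and "\<And>n. n \<in> S \<Longrightarrow> regular_graph (d n) (G n)"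
    and "\<And>n. n \<in> S \<Longrightarrow> v n \<in> verts (G n)"
    and "whp S (\<lambda>n. runtime_law (G n) (v n)) (\<lambda>n \<tau>. ereal_of_enat \<tau> \<le> ereal (T n))"
    and "\<epsilon> > 0"
    and "\<And>n. n \<in> S \<Longrightarrow> 0 < p n \<and> p n < 1"
    and "T \<in> o[sizes_at_top S](\<lambda>n. p n * real (d n))"
  shows "whp S (\<lambda>n. percolated_runtime_law (G n) (p n) (v n))
           (\<lambda>n \<tau>. ereal_of_enat \<tau> \<le> ereal ((1 + \<epsilon>) * T n))"
proof -
  note simple = assms(2) and card = assms(3) and regular = assms(5) and start = assms(6) and \<epsilon> = assms(8) and p = assms(9)
  define F where "F = sizes_at_top S"
  define P where "P n = measure (runtime_law (G n) (v n)) {\<tau> \<in> space (runtime_law (G n) (v n)). ereal_of_enat \<tau> \<le> ereal (T n)}" for n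
  define P' where "P' n = measure (percolated_runtime_law (G n) (p n) (v n))
    {\<tau> \<in> space (percolated_runtime_law (G n) (p n) (v n)). ereal_of_enat \<tau> \<le> ereal ((1 + \<epsilon>) * T n)}" for n
  define N where "N n = nat \<lfloor>T n\<rfloor>" for n
  have P: "(P \<longlongrightarrow> 1) F" using assms(7) unfolding whp_def P_def F_def .
  have inS: "eventually (\<lambda>n. n \<in> S) F" by (simp add: F_def eventually_sizes_at_top)
  \<comment> \<open>\<open>K\<close> is so large that the extra rounds, each gaining
    \<open>(1 / 8) ^ K\<close>, outweigh the factor \<open>4\<close> lost per clock step.\<close>
  obtain K :: nat where "2 / \<epsilon> \<le> K" using real_arch_simple by blast
  then have K: "2 \<le> \<epsilon> * K" using \<epsilon> by (simp add: field_simps)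
  have K0: "K \<noteq> 0" using K by (intro notI) simp
  define \<rho> where "\<rho> = (1 / 8 :: real) ^ K"
  have \<rho>: "0 < \<rho>" "\<rho> \<le> 1 / 8"
    using K0 power_decreasing[of 1 K "1 / 8 :: real"] by (auto simp: \<rho>_def)
  \<comment> \<open>The loss probability \<open>4 * \<delta> = \<rho> / 2\<close> and the base
    \<open>y = \<rho> / 4\<close> give \<open>4 * \<delta> + 2 * y = \<rho>\<close>.\<close>
  define \<delta> where "\<delta> = \<rho> / 8"
  have \<delta>: "0 < \<delta>" "\<delta> < 1" using \<rho> by (simp_all add: \<delta>_def)
  \<comment> \<open>The first bound keeps the number of rounds below
    \<open>\<delta> * ((1 - \<delta>) * \<mu>)\<close> with \<open>\<mu> = p n * d n\<close>. The
    second makes the Chernoff exponent at least \<open>2 * T n\<close>, which beats the factor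
    \<open>n \<le> 2 ^ N n\<close> of the union bound.\<close>
  define c where "c = min (\<delta> * (1 - \<delta>) / (1 + \<epsilon>)) (\<delta>\<^sup>2 / 8)"
  have c: "0 < c" using \<delta> \<epsilon> by (simp add: c_def)
  have small: "eventually (\<lambda>n. norm (T n) \<le> c * norm (p n * real (d n))) F"
    using landau_o.smallD[OF assms(10) c] unfolding F_def .
  \<comment> \<open>A positive success probability forces \<open>T n \<ge> 0\<close> and, by
    doubling, \<open>n \<le> 2 ^ N n\<close>, so \<open>N\<close> tends to infinity.\<close>
  have Ppos: "eventually (\<lambda>n. 0 < P n) F" using P by (rule order_tendstoD) simp
  have basic: "eventually (\<lambda>n. 0 \<le> T n \<and> n \<le> 2 ^ N n) F"
    using Ppos inS
  proof eventually_elim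
    case (elim n)
    then have "0 \<le> T n" unfolding P_def by (intro runtime_bound_nonneg)
    moreover have "n \<le> 2 ^ N n"
      using card_verts_le_of_runtime[OF simple[OF elim(2)] start[OF elim(2)] \<open>0 \<le> T n\<close>] elim card[OF elim(2)]
      unfolding P_def N_def by simp
    ultimately show ?case by simp
  qed
  have Nlim: "filterlim N at_top F"
  proof (rule filterlim_at_top[THEN iffD2], intro allI)
    fix m
    have "eventually (\<lambda>n. 2 ^ m \<le> n) F"
      unfolding F_def eventually_sizes_at_top by (rule eventually_mono[OF eventually_ge_at_top[of "2 ^ m"]]) simp
    with basic show "eventually (\<lambda>n. m \<le> N n) F"
    proof eventually_elim
      case (elim n)
      then have "2 ^ m \<le> (2 :: nat) ^ N n" by linarith
      then show ?case by simp
    qed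
  qed
  \<comment> \<open>The three summands provide the rounding room in \<open>slowed_push_tail\<close>,
    the bound \<open>1 \<le> \<delta> * \<mu>\<close>, and \<open>1 \<le> N n\<close>, from which
    \<open>0 < \<mu>\<close> follows.\<close>
  have large: "eventually (\<lambda>n. nat \<lceil>2 / \<epsilon>\<rceil> + nat \<lceil>c / \<delta>\<rceil> + 1 \<le> N n) F"
    using Nlim unfolding filterlim_at_top by blast
  have bound: "eventually (\<lambda>n. 1 - P' n \<le> (1 - P n) + (1 / 2) ^ N n + 2 / \<delta> * exp (- real (N n))) F"
    using small basic large inS
  proof eventually_elim
    case (elim n)
    define \<mu> where "\<mu> = p n * real (d n)"
    have T: "0 \<le> T n" using elim by simp
    have NT: "real (N n) \<le> T n" using T by (simp add: N_def)
    have Nge: "2 / \<epsilon> \<le> N n" "c / \<delta> \<le> N n" "1 \<le> real (N n)"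
      using elim by (auto simp: le_nat_iff) linarith+
    have pn: "0 < p n" "p n \<le> 1" using p[of n] elim by auto
    have T\<mu>: "T n \<le> c * \<mu>" using elim T pn by (simp add: \<mu>_def)
    have \<mu>0: "0 < \<mu>" using T\<mu> NT Nge c by (smt (verit) mult_nonneg_nonpos)
    have d: "0 < d n" using \<mu>0 by (cases "d n = 0") (auto simp: \<mu>_def)
    have x: "0 \<le> (1 + \<epsilon>) * T n" using T \<epsilon> by simp
    have "c / \<delta> \<le> c * \<mu>" using Nge NT T\<mu> by linarith
    then have \<mu>1: "1 \<le> \<delta> * \<mu>" using c \<delta> by (simp add: field_simps)
    have "real (nat \<lfloor>(1 + \<epsilon>) * T n\<rfloor>) \<le> (1 + \<epsilon>) * T n" using x by simp
    also have "\<dots> \<le> (1 + \<epsilon>) * (\<delta> * (1 - \<delta>) / (1 + \<epsilon>) * \<mu>)"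
    proof (intro mult_left_mono order_trans[OF T\<mu>] mult_right_mono)
      show "c \<le> \<delta> * (1 - \<delta>) / (1 + \<epsilon>)" by (simp add: c_def)
    qed (use \<mu>0 \<epsilon> in auto)
    also have "\<dots> = \<delta> * ((1 - \<delta>) * \<mu>)" using \<epsilon> by simp
    finally have steps: "real (nat \<lfloor>(1 + \<epsilon>) * T n\<rfloor>) \<le> \<delta> * ((1 - \<delta>) * \<mu>)" .
    have "1 - P' n \<le> (1 - P n) + (4 * \<delta> + 2 * (\<rho> / 4)) ^ nat \<lfloor>(1 + \<epsilon>) * T n\<rfloor> / (\<rho> / 4) ^ nat \<lfloor>T n\<rfloor>
        + 2 * card (verts (G n)) * exp (- \<delta>\<^sup>2 * (p n * d n) / 4) / \<delta>"
      unfolding P_def P'_def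
    proof (rule percolated_runtime_tail[OF simple regular start])
      show "(1 - 4 * \<delta>) / d n \<le> p n * ((1 - \<delta>) * (p n * d n) / ((1 - \<delta>) * (p n * d n) + 1)) ^ nat \<lfloor>(1 + \<epsilon>) * T n\<rfloor>
        / ((1 + \<delta>) * (p n * d n) + 1) * (1 - \<delta>)"
        using pick_rate_lower_bound[OF pn(1) \<mu>_def \<mu>1 \<delta> steps] by (simp only: \<mu>_def)
    qed (use elim pn d T x \<delta> \<rho> in \<open>auto simp: \<delta>_def\<close>)
    also have "4 * \<delta> + 2 * (\<rho> / 4) = \<rho>" by (simp add: \<delta>_def)
    also have "\<rho> ^ nat \<lfloor>(1 + \<epsilon>) * T n\<rfloor> / (\<rho> / 4) ^ nat \<lfloor>T n\<rfloor> \<le> (1 / 2) ^ N n"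
      unfolding \<rho>_def N_def
    proof (rule slowed_push_tail[OF K \<epsilon> T])
      show "1 \<le> \<epsilon> / 2 * nat \<lfloor>T n\<rfloor>" using Nge(1) \<epsilon> by (simp add: N_def field_simps)
    qed
    also have "2 * card (verts (G n)) * exp (- \<delta>\<^sup>2 * (p n * d n) / 4) / \<delta> \<le> 2 / \<delta> * exp (- real (N n))"
    proof -
      have "real n \<le> 2 ^ N n" using elim by (metis of_nat_le_iff of_nat_numeral of_nat_power)
      also have "\<dots> \<le> exp 1 ^ N n" using exp_ge_add_one_self[of 1] by (intro power_mono) auto
      also have "\<dots> = exp (real (N n))" by (simp add: exp_of_nat_mult[symmetric])
      finally have n: "real n \<le> exp (real (N n))" .
      have "real (N n) \<le> \<delta>\<^sup>2 / 8 * \<mu>"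
      proof -
        have "c \<le> \<delta>\<^sup>2 / 8" unfolding c_def by (rule min.cobounded2)
        then have "c * \<mu> \<le> \<delta>\<^sup>2 / 8 * \<mu>" using \<mu>0 by (intro mult_right_mono) auto
        with NT T\<mu> show ?thesis by linarith
      qed
      then have e: "exp (- \<delta>\<^sup>2 * \<mu> / 4) \<le> exp (- 2 * real (N n))" by simp
      \<comment> \<open>The number of vertices uses up half of the exponent
        \<open>2 * N n\<close>.\<close>
      have "real n * exp (- \<delta>\<^sup>2 * \<mu> / 4) \<le> exp (real (N n)) * exp (- 2 * real (N n))"
        by (rule mult_mono[OF n e]) auto
      also have "\<dots> = exp (- real (N n))" by (simp add: exp_add[symmetric])
      finally have "2 / \<delta> * (real n * exp (- \<delta>\<^sup>2 * \<mu> / 4)) \<le> 2 / \<delta> * exp (- real (N n))"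
        using \<delta> by (intro mult_left_mono) auto
      then show ?thesis using card elim by (simp add: \<mu>_def)
    qed
    finally show ?case by simp
  qed
  have upper: "eventually (\<lambda>n. P' n \<le> 1) F"
    using inS
  proof eventually_elim
    case (elim n)
    have "prob_space (percolated_runtime_law (G n) (p n) (v n))"
      using simple[OF elim] by (intro prob_space_percolated_runtime_law) (simp add: simple_graph_def)
    then show ?case unfolding P'_def by (rule prob_space.prob_le_1)
  qed
  have "((\<lambda>n. 1 - ((1 - P n) + (1 / 2) ^ N n + 2 / \<delta> * exp (- real (N n)))) \<longlongrightarrow> 1 - ((1 - 1) + 0 + 2 / \<delta> * 0)) F"
  proof (intro tendsto_intros P)
    show "((\<lambda>n. (1 / 2 :: real) ^ N n) \<longlongrightarrow> 0) F"
      by (rule filterlim_compose[OF LIMSEQ_power_zero Nlim]) simp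
    have "(\<lambda>k. exp (- real k)) \<longlonglongrightarrow> 0"
      by (rule filterlim_compose[OF exp_at_bot])
         (simp add: filterlim_uminus_at_bot filterlim_real_sequentially)
    then show "((\<lambda>n. exp (- real (N n))) \<longlongrightarrow> 0) F"
      by (rule filterlim_compose[OF _ Nlim])
  qed
  then have lim: "((\<lambda>n. 1 - ((1 - P n) + (1 / 2) ^ N n + 2 / \<delta> * exp (- real (N n)))) \<longlongrightarrow> 1) F"
    by simp
  have lower: "eventually (\<lambda>n. 1 - ((1 - P n) + (1 / 2) ^ N n + 2 / \<delta> * exp (- real (N n))) \<le> P' n) F"
    by (rule eventually_mono[OF bound]) linarith
  have "(P' \<longlongrightarrow> 1) F"
    by (rule tendsto_sandwich[OF lower upper lim tendsto_const])
  then show ?thesis unfolding whp_def P'_def F_def .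
qed

end
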